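(* Let $0<\beta<\beta_c$, $b\in\{1,0,-1\}$ and $k\in\mathbb R$, $k\neq0$, and assume that $K'(\beta)b-k<0$. For $\alpha>0$ define $$\beta_n=\beta+b/n^\alpha,\qquad K_n=K(\beta)+k/n^\alpha .$$ Let $$g(x)=\beta\bigl(K'(\beta)b-k\bigr)x^2+c_4(\beta)x^4,\qquad \tilde g(x)=c_4(\beta)x^4,\qquad c_4(\beta)=\frac{(e^\beta+2)^2(4-e^\beta)}{8\cdot4!},$$ let $\bar x>0$ be the unique positive global minimum point of $g$, and let $$\bar y=\frac{\int_{\mathbb R}|x|\exp[-\tilde g(x)]\,dx}{\int_{\mathbb R}\exp[-\tilde g(x)]\,dx},\qquad \bar z=\frac{\int_{\mathbb R}|x|\exp[-g(x)]\,dx}{\int_{\mathbb R}\exp[-g(x)]\,dx}.$$ Then: (a) For all $\alpha>0$, $m(\beta_n,K_n)\sim\bar x/n^{\alpha/2}$. If $b\neq0$, then $m(\beta_n,K_n)\sim\bar x|\beta-\beta_n|^{1/2}$. (b) For all $0<\alpha<\alpha_0=1/2$, $E_{n,\beta_n,K_n}\{|S_n/n|\}\sim\bar x/n^{\alpha/2}\sim m(\beta_n,K_n)$. (c) For all $\alpha>\alpha_0=1/2$, $E_{n,\beta_n,K_n}\{|S_n/n|\}\sim\bar y/n^{1/4}\gg m(\beta_n,K_n)$. (d) For $\alpha=\alpha_0=1/2$, $E_{n,\beta_n,K_n}\{|S_n/n|\}\sim\bar z/n^{1/4}\sim\bar z\cdot m(\beta_n,K_n)/\bar x$.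
   Context: Mean-field Blume--Capel model. Let $\Lambda=\{1,0,-1\}$. For $n\in\mathbb N$, $K>0$ and $\omega=(\omega_1,\dots,\omega_n)\in\Lambda^n$ put $S_n(\omega)=\sum_{j=1}^n\omega_j$ and $H_{n,K}(\omega)=\sum_{j=1}^n\omega_j^2-\frac Kn\bigl(\sum_{j=1}^n\omega_j\bigr)^2$. For $\beta>0$, $P_{n,\beta,K}$ is the probability measure on $\Lambda^n$ giving $\omega$ probability proportional to $\exp[-\beta H_{n,K}(\omega)]$; $E_{n,\beta,K}$ denotes expectation with respect to $P_{n,\beta,K}$. Free-energy functional: $c_\beta(t)=\log\frac{1+e^{-\beta}(e^t+e^{-t})}{1+2e^{-\beta}}$ and $G_{\beta,K}(x)=\beta Kx^2-c_\beta(2\beta Kx)$ for $x\in\mathbb R$. $\mathcal M_{\beta,K}$ is the set of global minimum points of $G_{\beta,K}$. Let $\beta_c=\log4$ and $K(\beta)=(e^\beta+2)/(4\beta)$ for $\beta>0$; $K'$ is the derivative of this function. The phase-coexistence region is the set of $(\beta,K)$, $\beta,K>0$, for which $\mathcal M_{\beta,K}$ has more than one element. It is known that for such $(\beta,K)$, $\mathcal M_{\beta,K}$ is $\{\pm m(\beta,K)\}$ or $\{0,\pm m(\beta,K)\}$ with $m(\beta,K)>0$; this unique positive global minimum point $m(\beta,K)$ is the thermodynamic magnetization. Notation: $a_n\sim b_n$ means $a_n/b_n\to1$ and $a_n\gg b_n$ means $a_n/b_n\to\infty$ as $n\to\infty$. All quantities are considered for $n$ large enough that $\beta_n,K_n>0$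 and $(\beta_n,K_n)$ lies in the phase-coexistence region (which holds for all sufficiently large $n$ under the stated assumptions). *)

theory Defs
  imports "HOL-Probability.Probability" "HOL-Library.Landau_Symbols"
begin

section \<open>The mean-field Blume--Capel model\<close>

definition configs :: "nat \<Rightarrow> (nat \<Rightarrow> real) set" where
  "configs n = {1..n} \<rightarrow>\<^sub>E {1, 0, -1}"

definition total_spin :: "nat \<Rightarrow> (nat \<Rightarrow> real) \<Rightarrow> real" where
  "total_spin n \<omega> = (\<Sum>j = 1..n. \<omega> j)"

definition hamiltonian :: "nat \<Rightarrow> real \<Rightarrow> (nat \<Rightarrow> real) \<Rightarrow> real" where
  "hamiltonian n K \<omega> = (\<Sum>j = 1..n. (\<omega> j)\<^sup>2) - K / real n * (\<Sum>j = 1..n. \<omega> j)\<^sup>2"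

definition partition_fun :: "nat \<Rightarrow> real \<Rightarrow> real \<Rightarrow> real" where
  "partition_fun n \<beta> K = (\<Sum>\<omega>\<in>configs n. exp (- \<beta> * hamiltonian n K \<omega>))"

definition blume_capel :: "nat \<Rightarrow> real \<Rightarrow> real \<Rightarrow> (nat \<Rightarrow> real) measure" where
  "blume_capel n \<beta> K = point_measure (configs n)
     (\<lambda>\<omega>. ennreal (exp (- \<beta> * hamiltonian n K \<omega>) / partition_fun n \<beta> K))"

lemma prob_space_blume_capel: "prob_space (blume_capel n \<beta> K)"
proof -
  have fin: "finite (configs n)"
    unfolding configs_def by (intro finite_PiE) auto
  have "(\<lambda>j\<in>{1..n}. 0) \<in> configs n"
    by (auto simp: configs_def)
  then have ne: "configs n \<noteq> {}"
    by blast
  have pos: "partition_fun n \<beta> K > 0"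
    unfolding partition_fun_def using fin ne by (intro sum_pos) auto
  have "emeasure (blume_capel n \<beta> K) (configs n) =
      (\<Sum>\<omega>\<in>configs n. ennreal (exp (- \<beta> * hamiltonian n K \<omega>) / partition_fun n \<beta> K))"
    unfolding blume_capel_def by (rule emeasure_point_measure_finite[OF fin subset_refl])
  also have "\<dots> = ennreal (\<Sum>\<omega>\<in>configs n. exp (- \<beta> * hamiltonian n K \<omega>) / partition_fun n \<beta> K)"
    using pos by (intro sum_ennreal) (auto intro: divide_nonneg_pos)
  also have "\<dots> = 1"
    using pos by (simp add: sum_divide_distrib[symmetric]) (simp add: partition_fun_def)
  finally show ?thesis
    by (intro prob_spaceI) (simp add: blume_capel_def space_point_measure)
qed

definition mean_abs_magnetization :: "nat \<Rightarrow> real \<Rightarrow> real \<Rightarrow> real" where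
  "mean_abs_magnetization n \<beta> K = (\<integral>\<omega>. \<bar>total_spin n \<omega> / real n\<bar> \<partial>blume_capel n \<beta> K)"

section \<open>Free-energy functional and thermodynamic magnetization\<close>

definition global_min_points :: "(real \<Rightarrow> real) \<Rightarrow> real set" where
  "global_min_points f = {x. \<forall>y. f x \<le> f y}"

definition positive_min_point :: "(real \<Rightarrow> real) \<Rightarrow> real" where
  "positive_min_point f = (THE x. x > 0 \<and> x \<in> global_min_points f)"

definition cumulant_gf :: "real \<Rightarrow> real \<Rightarrow> real" where
  "cumulant_gf \<beta> t = ln ((1 + exp (- \<beta>) * (exp t + exp (- t))) / (1 + 2 * exp (- \<beta>)))"

definition free_energy :: "real \<Rightarrow> real \<Rightarrow> real \<Rightarrow> real" where
  "free_energy \<beta> K x = \<beta> * K * x\<^sup>2 - cumulant_gf \<beta> (2 * \<beta> * K * x)"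

text \<open>
  The functional is even, so it can have a positive global minimum point only if it has at least
  two global minimum points, that is, only in the phase-coexistence region. There the positive
  global minimum point is unique; outside that region the value below is unspecified.
\<close>
definition magnetization :: "real \<Rightarrow> real \<Rightarrow> real" where
  "magnetization \<beta> K = positive_min_point (free_energy \<beta> K)"

section \<open>The approach to the second-order curve\<close>

definition beta_crit :: real where
  "beta_crit = ln 4"

definition K_curve :: "real \<Rightarrow> real" where
  "K_curve \<beta> = (exp \<beta> + 2) / (4 * \<beta>)"

definition beta_seq :: "real \<Rightarrow> real \<Rightarrow> real \<Rightarrow> nat \<Rightarrow> real" where
  "beta_seq \<beta> b \<alpha> n = \<beta> + b / real n powr \<alpha>"

definition K_seq :: "real \<Rightarrow> real \<Rightarrow> real \<Rightarrow> nat \<Rightarrow> real" where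
  "K_seq \<beta> k \<alpha> n = K_curve \<beta> + k / real n powr \<alpha>"

definition c4 :: "real \<Rightarrow> real" where
  "c4 \<beta> = (exp \<beta> + 2)\<^sup>2 * (4 - exp \<beta>) / (8 * fact 4)"

definition gl_poly :: "real \<Rightarrow> real \<Rightarrow> real \<Rightarrow> real \<Rightarrow> real" where
  "gl_poly \<beta> b k x = \<beta> * (deriv K_curve \<beta> * b - k) * x\<^sup>2 + c4 \<beta> * x ^ 4"

definition gl_poly_tilde :: "real \<Rightarrow> real \<Rightarrow> real" where
  "gl_poly_tilde \<beta> x = c4 \<beta> * x ^ 4"

definition gibbs_abs_mean :: "(real \<Rightarrow> real) \<Rightarrow> real" where
  "gibbs_abs_mean f = (\<integral>x. \<bar>x\<bar> * exp (- f x) \<partial>lborel) / (\<integral>x. exp (- f x) \<partial>lborel)"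

definition x_bar :: "real \<Rightarrow> real \<Rightarrow> real \<Rightarrow> real" where
  "x_bar \<beta> b k = positive_min_point (gl_poly \<beta> b k)"

definition y_bar :: "real \<Rightarrow> real" where
  "y_bar \<beta> = gibbs_abs_mean (gl_poly_tilde \<beta>)"

definition z_bar :: "real \<Rightarrow> real \<Rightarrow> real \<Rightarrow> real" where
  "z_bar \<beta> b k = gibbs_abs_mean (gl_poly \<beta> b k)"

definition m_seq :: "real \<Rightarrow> real \<Rightarrow> real \<Rightarrow> real \<Rightarrow> nat \<Rightarrow> real" where
  "m_seq \<beta> b k \<alpha> n = magnetization (beta_seq \<beta> b \<alpha> n) (K_seq \<beta> k \<alpha> n)"

definition E_seq :: "real \<Rightarrow> real \<Rightarrow> real \<Rightarrow> real \<Rightarrow> nat \<Rightarrow> real" where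
  "E_seq \<beta> b k \<alpha> n = mean_abs_magnetization n (beta_seq \<beta> b \<alpha> n) (K_seq \<beta> k \<alpha> n)"

end

theory Submission
  imports Defs "HOL-Real_Asymp.Real_Asymp"
begin

text \<open>
  The proof reduces every part to the free energy \<open>G\<close> seen on a small length scale \<open>\<epsilon>\<close>. Write
  \<open>p = 2 / (exp \<beta> + 2)\<close> for the second moment of a single non-interacting spin. The cumulant
  generating function is \<open>ln (1 + p (cosh t - 1))\<close>, so \<open>G\<close> splits exactly into a quadratic term, whose
  coefficient vanishes when \<open>K = K_curve \<beta>\<close>, and a remainder that is of fourth order at the origin.
  The hypothesis \<open>\<beta> < ln 4\<close> means \<open>p > 1/3\<close>, and this single inequality has three consequences:

  \<^item> the fourth-order coefficient \<open>p (3 p - 1) / 24\<close> of the remainder is positive;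
  \<^item> the remainder is globally at least a positive multiple of \<open>t ^ 4 / (2 + t\<^sup>2)\<close>;
  \<^item> \<open>G' x / x\<close> increases strictly for \<open>x > 0\<close>, so \<open>G\<close> is quasiconvex on the half-line and has at
    most one positive global minimum point.

  If \<open>\<epsilon> \<rightarrow> 0\<close> and the quadratic coefficient is \<open>L \<epsilon>\<^sup>2\<close> to leading order, then \<open>G (\<epsilon> y) / \<epsilon> ^ 4\<close>
  converges pointwise to \<open>L y\<^sup>2 + c4 \<beta> y ^ 4\<close> and is bounded below by \<open>y\<^sup>2 - B\<close> with one constant \<open>B\<close>.
  Pointwise convergence is enough: quasiconvexity upgrades it to control of where the functions are
  small. This yields \<open>magnetization_limit\<close>, hence part (a), with \<open>\<epsilon> = n powr (- \<alpha> / 2)\<close>, for which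
  \<open>L = \<beta> (K' b - k)\<close> is negative.

  For the finite-size quantity, the Hubbard--Stratonovich transformation linearises the square of the
  total spin: adding to \<open>S\<^sub>n / n\<close> an independent centred Gaussian of size \<open>n powr (- 1 / 2)\<close> produces
  a variable with density proportional to \<open>exp (- n G)\<close>. Lemma \<open>hubbard_stratonovich\<close> therefore
  compares the mean of \<open>\<bar>S\<^sub>n / n\<bar>\<close> with the mean of \<open>\<bar>x\<bar>\<close> under that density up to an error of order
  \<open>n powr (- 1 / 2)\<close>, negligible on both scales used. The substitution \<open>x = \<epsilon> y\<close> turns \<open>n G\<close>
  into \<open>n \<epsilon> ^ 4\<close> times the rescaled energy. For \<open>\<alpha> < 1 / 2\<close> and \<open>\<epsilon> = n powr (- \<alpha> / 2)\<close> the factor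
  \<open>n \<epsilon> ^ 4\<close> diverges, and the Laplace principle \<open>gibbs_abs_mean_laplace\<close> concentrates the mean at the
  minimum point: part (b). For \<open>\<alpha> \<ge> 1 / 2\<close> and \<open>\<epsilon> = n powr (- 1 / 4)\<close> the factor is \<open>1\<close>, and
  dominated convergence (\<open>gibbs_abs_mean_tendsto\<close>) gives the Gibbs mean of the limiting polynomial,
  with \<open>L = \<beta> (K' b - k)\<close> when \<open>\<alpha> = 1 / 2\<close> and \<open>L = 0\<close> when \<open>\<alpha> > 1 / 2\<close>: parts (d) and (c).
\<close>

section \<open>The single-spin cumulant beyond second order\<close>

lemma nonneg_if_deriv_nonneg:
  fixes f :: "real \<Rightarrow> real"
  assumes "\<And>t. 0 \<le> t \<Longrightarrow> (f has_real_derivative f' t) (at t)" "\<And>t. 0 \<le> t \<Longrightarrow> 0 \<le> f' t"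
    and "0 \<le> f 0" "0 \<le> t"
  shows "0 \<le> f t"
proof -
  have "f 0 \<le> f t"
    by (rule DERIV_nonneg_imp_nondecreasing[OF assms(4)]) (use assms(1,2) in blast)
  with assms(3) show ?thesis by simp
qed

lemma cosh_minus_one_ge: "(t::real)\<^sup>2 / 2 \<le> cosh t - 1"
proof -
  have sinh_ge: "t \<le> sinh t" if "0 \<le> t" for t :: real
  proof -
    have "0 \<le> sinh t - t"
      by (rule nonneg_if_deriv_nonneg[where f = "\<lambda>t. sinh t - t" and f' = "\<lambda>t. cosh t - 1"])
         (auto intro!: derivative_eq_intros simp: cosh_real_ge_1 that)
    then show ?thesis by simp
  qed
  have "0 \<le> cosh t - 1 - t\<^sup>2 / 2" if "0 \<le> t" for t :: real
    by (rule nonneg_if_deriv_nonneg[where f = "\<lambda>t. cosh t - 1 - t\<^sup>2 / 2" and f' = "\<lambda>t. sinh t - t"])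
       (auto intro!: derivative_eq_intros simp: sinh_ge that)
  from this[of "\<bar>t\<bar>"] show ?thesis by simp
qed

text \<open>
  Comparing Taylor coefficients, this is \<open>3 / (2 j + 1) \<le> 1\<close> for \<open>j \<ge> 1\<close>, with equality only in
  the cubic term; the constant \<open>3\<close> is the source of the threshold \<open>p = 1/3\<close> below. Three
  differentiations reduce the inequality to \<open>t sinh t \<ge> 0\<close>.
\<close>
lemma sinh_minus_self_le:
  fixes t :: real
  assumes "0 \<le> t"
  shows "3 * (sinh t - t) \<le> t * (cosh t - 1)"
proof -
  have 1: "0 \<le> t * cosh t - sinh t" if "0 \<le> t" for t :: real
    by (rule nonneg_if_deriv_nonneg[where f = "\<lambda>t. t * cosh t - sinh t" and f' = "\<lambda>t. t * sinh t"])
       (auto intro!: derivative_eq_intros simp: that)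
  have 2: "0 \<le> t * sinh t + 2 - 2 * cosh t" if "0 \<le> t" for t :: real
    by (rule nonneg_if_deriv_nonneg[where f = "\<lambda>t. t * sinh t + 2 - 2 * cosh t"
          and f' = "\<lambda>t. t * cosh t - sinh t", OF _ 1])
       (auto intro!: derivative_eq_intros simp: that)
  have "0 \<le> t * (cosh t - 1) - 3 * (sinh t - t)"
    by (rule nonneg_if_deriv_nonneg[where f = "\<lambda>t. t * (cosh t - 1) - 3 * (sinh t - t)"
          and f' = "\<lambda>t. t * sinh t + 2 - 2 * cosh t", OF _ 2])
       (auto intro!: derivative_eq_intros simp: algebra_simps assms)
  then show ?thesis by simp
qed

text \<open>
  The mean of a spin in an external field \<open>t\<close>, that is, the derivative of the cumulant generating
  function.
\<close>
definition spin_ratio :: "real \<Rightarrow> real \<Rightarrow> real" where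
  "spin_ratio p t = p * sinh t / (1 + p * (cosh t - 1))"

text \<open>
  What remains of minus the cumulant generating function once its second-order term is split off.
\<close>
definition quartic_part :: "real \<Rightarrow> real \<Rightarrow> real" where
  "quartic_part p t = p * t\<^sup>2 / 2 - ln (1 + p * (cosh t - 1))"

lemma mgf_pos: "0 \<le> p \<Longrightarrow> 0 < 1 + p * (cosh t - 1)" for p t :: real
  using cosh_real_ge_1[of t] by (intro add_pos_nonneg mult_nonneg_nonneg) auto

lemma quartic_part_0 [simp]: "quartic_part p 0 = 0"
  by (simp add: quartic_part_def)

lemma quartic_part_abs [simp]: "quartic_part p \<bar>t\<bar> = quartic_part p t"
  by (simp add: quartic_part_def)

lemma quartic_part_deriv:
  assumes "0 \<le> p"
  shows "(quartic_part p has_real_derivative p * t - spin_ratio p t) (at t)"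
  using mgf_pos[OF assms, of t] unfolding quartic_part_def[abs_def] spin_ratio_def
  by (auto intro!: derivative_eq_intros)

lemma spin_ratio_deriv:
  assumes "0 \<le> p"
  shows "(spin_ratio p has_real_derivative
           p * (1 + (1 - p) * (cosh t - 1)) / (1 + p * (cosh t - 1))\<^sup>2) (at t)"
proof -
  have "p * (cosh t * (1 + p * (cosh t - 1)) - p * (sinh t)\<^sup>2) = p * (1 + (1 - p) * (cosh t - 1))"
    unfolding sinh_square_eq by (simp add: algebra_simps power2_eq_square)
  then show ?thesis
    using mgf_pos[OF assms, of t] unfolding spin_ratio_def[abs_def]
    by (auto intro!: derivative_eq_intros simp: power2_eq_square algebra_simps)
qed

text \<open>
  With \<open>v = cosh t - 1\<close> this says that the second derivative of the cumulant generating function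
  decreases for \<open>t > 0\<close>: after clearing denominators, the difference of the two sides is
  \<open>v - u\<close> times the sum of \<open>3 p - 1\<close> and nonnegative terms.
\<close>
lemma spin_ratio_deriv_antimono:
  fixes p u v :: real
  assumes p: "1/3 < p" "p \<le> 1" and uv: "0 \<le> u" "u < v"
  shows "(1 + (1 - p) * v) / (1 + p * v)\<^sup>2 < (1 + (1 - p) * u) / (1 + p * u)\<^sup>2"
proof -
  have "(1 + (1 - p) * u) * (1 + p * v)\<^sup>2 - (1 + (1 - p) * v) * (1 + p * u)\<^sup>2
      = (v - u) * ((3 * p - 1) + p\<^sup>2 * (u + v) + p\<^sup>2 * (1 - p) * (u * v))"
    by algebra
  moreover have "0 < (v - u) * ((3 * p - 1) + p\<^sup>2 * (u + v) + p\<^sup>2 * (1 - p) * (u * v))"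
    using p uv by (intro mult_pos_pos add_pos_nonneg mult_nonneg_nonneg) auto
  moreover have "0 < 1 + p * u" "0 < 1 + p * v"
    using p uv by (auto intro!: add_pos_nonneg)
  ultimately show ?thesis
    by (simp add: divide_simps)
qed

text \<open>
  A function vanishing at \<open>0\<close> whose derivative decreases lies below its chords from the origin: its
  average slope on \<open>[0, s]\<close> exceeds its average slope on \<open>[s, t]\<close>.
\<close>
lemma spin_ratio_over_self_decreasing:
  assumes p: "1/3 < p" "p \<le> 1" and st: "0 < s" "s < t"
  shows "spin_ratio p t / t < spin_ratio p s / s"
proof -
  define D where "D t = p * ((1 + (1 - p) * (cosh t - 1)) / (1 + p * (cosh t - 1))\<^sup>2)" for t
  have der: "DERIV (spin_ratio p) x :> D x" for x
    unfolding D_def times_divide_eq_right using p by (intro spin_ratio_deriv) auto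
  obtain z1 where z1: "0 < z1" "z1 < s" "spin_ratio p s - spin_ratio p 0 = (s - 0) * D z1"
    using MVT2[OF st(1), of "spin_ratio p" D] der by blast
  obtain z2 where z2: "s < z2" "z2 < t" "spin_ratio p t - spin_ratio p s = (t - s) * D z2"
    using MVT2[OF st(2), of "spin_ratio p" D] der by blast
  have "cosh z1 < cosh z2"
    using z1 z2 by (intro cosh_real_strict_mono) auto
  then have "D z2 < D z1"
    unfolding D_def using p cosh_real_ge_1[of z1]
    by (intro mult_strict_left_mono spin_ratio_deriv_antimono) auto
  then have "(t - s) * D z2 < (t - s) * D z1"
    using st by simp
  moreover have "spin_ratio p s = s * D z1"
    using z1 by (simp add: spin_ratio_def)
  ultimately have "spin_ratio p t < t * D z1"
    using z2 by (simp add: algebra_simps)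
  with \<open>spin_ratio p s = s * D z1\<close> st show ?thesis
    by (simp add: field_simps)
qed

text \<open>
  For \<open>t \<ge> 0\<close> it suffices to compare derivatives, since both sides vanish at \<open>0\<close>. By
  \<open>sinh_minus_self_le\<close> the derivative of the remainder is at least
  \<open>p (p - 1/3) t (cosh t - 1) / (1 + p (cosh t - 1))\<close>, and \<open>cosh t - 1 \<ge> t\<^sup>2 / 2\<close> bounds this by a
  rational function. The growth at infinity is only quadratic, as it must be, because the cumulant
  generating function grows linearly.
\<close>
lemma quartic_part_ge:
  assumes p: "1/3 \<le> p" "p \<le> 1"
  shows "p * (p - 1/3) / 4 * (t ^ 4 / (2 + t\<^sup>2)) \<le> quartic_part p t"
proof -
  let ?c = "p * (p - 1/3)"
  have c0: "0 \<le> ?c" using p by simp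
  have main: "0 \<le> quartic_part p t - ?c / 4 * (t ^ 4 / (2 + t\<^sup>2))" if "0 \<le> t" for t
  proof (rule nonneg_if_deriv_nonneg[OF _ _ _ that])
    fix t :: real assume t: "0 \<le> t"
    have pos: "0 < 2 + t\<^sup>2" by (simp add: add_pos_nonneg)
    have "((\<lambda>t. t ^ 4 / (2 + t\<^sup>2)) has_real_derivative
       (4 * t ^ 3 * (2 + t\<^sup>2) - t ^ 4 * (2 * t)) / (2 + t\<^sup>2)\<^sup>2) (at t)"
      using pos by (auto intro!: derivative_eq_intros simp: power2_eq_square)
    then show "((\<lambda>t. quartic_part p t - ?c / 4 * (t ^ 4 / (2 + t\<^sup>2))) has_real_derivative
       (p * t - spin_ratio p t) - ?c / 4 * ((4 * t ^ 3 * (2 + t\<^sup>2) - t ^ 4 * (2 * t)) / (2 + t\<^sup>2)\<^sup>2)) (at t)"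
      using p by (intro DERIV_diff DERIV_cmult quartic_part_deriv) auto
    let ?v = "cosh t - 1"
    have M: "0 < 1 + p * ?v" using mgf_pos[of p t] p by simp
    have v: "t\<^sup>2 / 2 \<le> ?v" by (rule cosh_minus_one_ge)
    have v0: "0 \<le> ?v" using v by (smt (verit) zero_le_power2 divide_nonneg_pos)
    have "?c * (t ^ 3 / (2 + t\<^sup>2)) \<le> ?c * (t * ?v / (1 + p * ?v))"
    proof (rule mult_left_mono[OF _ c0])
      have "t\<^sup>2 * (p * ?v) \<le> t\<^sup>2 * (1 * ?v)"
        using p v0 by (intro mult_left_mono mult_right_mono) auto
      then have "t\<^sup>2 * (1 + p * ?v) \<le> ?v * (2 + t\<^sup>2)"
        using v by (simp add: algebra_simps)
      from mult_left_mono[OF this t] show "t ^ 3 / (2 + t\<^sup>2) \<le> t * ?v / (1 + p * ?v)"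
        using pos M by (simp add: divide_simps power2_eq_square power3_eq_cube mult_ac)
    qed
    also have "\<dots> \<le> p * t - spin_ratio p t"
    proof -
      have "(p - 1/3) * (t * ?v) \<le> t * (1 + p * ?v) - sinh t"
        using sinh_minus_self_le[OF t] by (simp add: algebra_simps)
      from mult_left_mono[OF this, of p] p have "?c * (t * ?v) \<le> p * t * (1 + p * ?v) - p * sinh t"
        by (simp add: algebra_simps)
      with M have "?c * (t * ?v) / (1 + p * ?v) \<le> (p * t * (1 + p * ?v) - p * sinh t) / (1 + p * ?v)"
        by (intro divide_right_mono) auto
      with M show ?thesis by (simp add: spin_ratio_def diff_divide_distrib)
    qed
    finally have 1: "?c * (t ^ 3 / (2 + t\<^sup>2)) \<le> p * t - spin_ratio p t" .
    have "(4 * t ^ 3 * (2 + t\<^sup>2) - t ^ 4 * (2 * t)) / (2 + t\<^sup>2)\<^sup>2 \<le> 4 * t ^ 3 * (2 + t\<^sup>2) / (2 + t\<^sup>2)\<^sup>2"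
      using t by (intro divide_right_mono) auto
    also have "\<dots> = 4 * (t ^ 3 / (2 + t\<^sup>2))"
      using pos by (simp add: power2_eq_square)
    finally have "?c / 4 * ((4 * t ^ 3 * (2 + t\<^sup>2) - t ^ 4 * (2 * t)) / (2 + t\<^sup>2)\<^sup>2)
        \<le> ?c / 4 * (4 * (t ^ 3 / (2 + t\<^sup>2)))"
      using c0 by (intro mult_left_mono) auto
    also have "\<dots> = ?c * (t ^ 3 / (2 + t\<^sup>2))"
      by simp
    finally have "?c / 4 * ((4 * t ^ 3 * (2 + t\<^sup>2) - t ^ 4 * (2 * t)) / (2 + t\<^sup>2)\<^sup>2)
        \<le> ?c * (t ^ 3 / (2 + t\<^sup>2))" .
    with 1 show "0 \<le> (p * t - spin_ratio p t) - ?c / 4 * ((4 * t ^ 3 * (2 + t\<^sup>2) - t ^ 4 * (2 * t)) / (2 + t\<^sup>2)\<^sup>2)"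
      by linarith
  qed simp
  from main[of "\<bar>t\<bar>"] show ?thesis by simp
qed

text \<open>
  The parameter \<open>p\<close> moves together with \<open>t\<close>, so the expansion is taken in pieces free of \<open>p\<close>: the
  Taylor quotients of \<open>cosh\<close> at \<open>0\<close> and that of \<open>ln (1 + u)\<close> along \<open>u = p (cosh t - 1)\<close>.
\<close>
lemma quartic_part_limit:
  assumes p: "(p \<longlongrightarrow> p0) F" "0 < p0" and t: "filterlim t (at 0) F"
  shows "((\<lambda>n. quartic_part (p n) (t n) / t n ^ 4) \<longlongrightarrow> p0 * (3 * p0 - 1) / 24) F"
proof -
  have c2: "((\<lambda>n. (cosh (t n) - 1) / (t n)\<^sup>2) \<longlongrightarrow> 1/2) F"
    by (rule filterlim_compose[OF _ t]) real_asymp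
  have c4: "((\<lambda>n. (cosh (t n) - 1 - (t n)\<^sup>2 / 2) / t n ^ 4) \<longlongrightarrow> 1/24) F"
    by (rule filterlim_compose[OF _ t]) real_asymp
  define u where "u n = p n * (cosh (t n) - 1)" for n
  have t0: "(t \<longlongrightarrow> 0) F" and tn: "\<forall>\<^sub>F n in F. t n \<noteq> 0"
    using t by (auto simp: filterlim_at)
  have pn: "\<forall>\<^sub>F n in F. 0 < p n"
    using p by (rule order_tendstoD)
  have "(u \<longlongrightarrow> p0 * (cosh 0 - 1)) F"
    unfolding u_def by (intro tendsto_intros p t0)
  moreover have "\<forall>\<^sub>F n in F. u n \<noteq> 0"
    using tn pn by eventually_elim (simp add: u_def)
  ultimately have u: "filterlim u (at 0) F"
    by (simp add: filterlim_at)
  have l2: "((\<lambda>n. (u n - ln (1 + u n)) / (u n)\<^sup>2) \<longlongrightarrow> 1/2) F"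
    by (rule filterlim_compose[OF _ u]) real_asymp
  have "((\<lambda>n. (u n - ln (1 + u n)) / (u n)\<^sup>2 * (p n * ((cosh (t n) - 1) / (t n)\<^sup>2))\<^sup>2
          - p n * ((cosh (t n) - 1 - (t n)\<^sup>2 / 2) / t n ^ 4)) \<longlongrightarrow> 1/2 * (p0 * (1/2))\<^sup>2 - p0 * (1/24)) F"
    by (intro tendsto_intros l2 c2 c4 p)
  also have "1/2 * (p0 * (1/2))\<^sup>2 - p0 * (1/24) = p0 * (3 * p0 - 1) / 24"
    by (simp add: power2_eq_square algebra_simps)
  finally have lim: "((\<lambda>n. (u n - ln (1 + u n)) / (u n)\<^sup>2 * (p n * ((cosh (t n) - 1) / (t n)\<^sup>2))\<^sup>2
          - p n * ((cosh (t n) - 1 - (t n)\<^sup>2 / 2) / t n ^ 4)) \<longlongrightarrow> p0 * (3 * p0 - 1) / 24) F" .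
  have eq: "\<forall>\<^sub>F n in F. (u n - ln (1 + u n)) / (u n)\<^sup>2 * (p n * ((cosh (t n) - 1) / (t n)\<^sup>2))\<^sup>2
          - p n * ((cosh (t n) - 1 - (t n)\<^sup>2 / 2) / t n ^ 4) = quartic_part (p n) (t n) / t n ^ 4"
    using tn pn
  proof eventually_elim
    case (elim n)
    then have u0: "u n \<noteq> 0" by (simp add: u_def)
    have "p n * ((cosh (t n) - 1) / (t n)\<^sup>2) = u n / (t n)\<^sup>2"
      by (simp add: u_def)
    then have "(p n * ((cosh (t n) - 1) / (t n)\<^sup>2))\<^sup>2 = (u n)\<^sup>2 / t n ^ 4"
      by (simp only: power_divide) simp
    with u0 have "(u n - ln (1 + u n)) / (u n)\<^sup>2 * (p n * ((cosh (t n) - 1) / (t n)\<^sup>2))\<^sup>2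
        = (u n - ln (1 + u n)) / t n ^ 4"
      by simp
    moreover have "p n * ((cosh (t n) - 1 - (t n)\<^sup>2 / 2) / t n ^ 4) = (u n - p n * (t n)\<^sup>2 / 2) / t n ^ 4"
      by (simp add: u_def algebra_simps)
    moreover have "quartic_part (p n) (t n) = (u n - ln (1 + u n)) - (u n - p n * (t n)\<^sup>2 / 2)"
      by (simp add: quartic_part_def u_def)
    ultimately show ?case
      by (simp only: diff_divide_distrib)
  qed
  from Lim_transform_eventually[OF lim eq] show ?thesis .
qed

section \<open>Shape of the free energy\<close>

definition spin_second_moment :: "real \<Rightarrow> real" where
  "spin_second_moment \<beta> = 2 / (exp \<beta> + 2)"

lemma spin_second_moment_bounds:
  assumes "0 < \<beta>" "\<beta> < beta_crit"
  shows "1/3 < spin_second_moment \<beta>" "spin_second_moment \<beta> \<le> 1"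
proof -
  have "exp \<beta> < 4"
    using assms unfolding beta_crit_def by (metis exp_less_cancel_iff exp_ln zero_less_numeral)
  then show "1/3 < spin_second_moment \<beta>"
    unfolding spin_second_moment_def by (simp add: less_divide_eq add_pos_pos)
  show "spin_second_moment \<beta> \<le> 1"
    unfolding spin_second_moment_def by (simp add: divide_le_eq add_pos_pos)
qed

lemma cumulant_gf_eq: "cumulant_gf \<beta> t = ln (1 + spin_second_moment \<beta> * (cosh t - 1))"
proof -
  have "(1 + exp (- \<beta>) * (exp t + exp (- t))) / (1 + 2 * exp (- \<beta>))
      = 1 + spin_second_moment \<beta> * (cosh t - 1)"
  proof -
    have "0 < exp \<beta> + 2" by (simp add: add_pos_pos)
    then show ?thesis
      unfolding spin_second_moment_def cosh_def
      by (simp add: exp_minus[of \<beta>] divide_simps) (simp add: algebra_simps)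
  qed
  then show ?thesis by (simp add: cumulant_gf_def)
qed

definition quadratic_coeff :: "real \<Rightarrow> real \<Rightarrow> real" where
  "quadratic_coeff \<beta> K = \<beta> * K * (1 - 2 * spin_second_moment \<beta> * \<beta> * K)"

lemma free_energy_split:
  "free_energy \<beta> K x
     = quadratic_coeff \<beta> K * x\<^sup>2 + quartic_part (spin_second_moment \<beta>) (2 * \<beta> * K * x)"
  unfolding free_energy_def cumulant_gf_eq quadratic_coeff_def quartic_part_def
  by (simp add: power2_eq_square algebra_simps)

lemma free_energy_0 [simp]: "free_energy \<beta> K 0 = 0"
  by (simp add: free_energy_split)

lemma free_energy_abs [simp]: "free_energy \<beta> K \<bar>x\<bar> = free_energy \<beta> K x"
  by (simp add: free_energy_def cumulant_gf_eq abs_if)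

lemma free_energy_deriv:
  "(free_energy \<beta> K has_real_derivative
      2 * \<beta> * K * (x - spin_ratio (spin_second_moment \<beta>) (2 * \<beta> * K * x))) (at x)"
proof -
  let ?p = "spin_second_moment \<beta>"
  have p: "0 \<le> ?p" by (simp add: spin_second_moment_def add_nonneg_nonneg)
  have "((\<lambda>x. quadratic_coeff \<beta> K * x\<^sup>2) has_real_derivative 2 * quadratic_coeff \<beta> K * x) (at x)"
    by (auto intro!: derivative_eq_intros)
  moreover have "((\<lambda>x. quartic_part ?p (2 * \<beta> * K * x)) has_real_derivative
      (?p * (2 * \<beta> * K * x) - spin_ratio ?p (2 * \<beta> * K * x)) * (2 * \<beta> * K)) (at x)"
    by (rule DERIV_chain2[OF quartic_part_deriv[OF p]]) (auto intro!: derivative_eq_intros)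
  ultimately have "(free_energy \<beta> K has_real_derivative 2 * quadratic_coeff \<beta> K * x +
      (?p * (2 * \<beta> * K * x) - spin_ratio ?p (2 * \<beta> * K * x)) * (2 * \<beta> * K)) (at x)"
    unfolding free_energy_split[abs_def] by (rule DERIV_add)
  then show ?thesis
    by (simp add: quadratic_coeff_def algebra_simps)
qed

lemma continuous_on_free_energy: "continuous_on A (free_energy \<beta> K)"
  by (intro continuous_at_imp_continuous_on ballI) (rule DERIV_isCont, rule free_energy_deriv)

text \<open>
  For \<open>x > 0\<close> the sign of the derivative is that of \<open>1 / r - spin_ratio p (r x) / (r x)\<close> with
  \<open>r = 2 \<beta> K\<close>, which increases strictly: once the free energy stops decreasing, it increases for good.
\<close>
lemma free_energy_deriv_sign_change:
  assumes \<beta>: "0 < \<beta>" "\<beta> < beta_crit" and K: "0 < K" and xy: "0 < x" "x < y"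
    and x: "(free_energy \<beta> K has_real_derivative d) (at x)" "0 \<le> d"
    and y: "(free_energy \<beta> K has_real_derivative e) (at y)"
  shows "0 < e"
proof -
  let ?r = "2 * \<beta> * K" and ?p = "spin_second_moment \<beta>"
  have r: "0 < ?r" using \<beta> K by simp
  have "0 \<le> ?r * (x - spin_ratio ?p (?r * x))"
    using DERIV_unique[OF x(1) free_energy_deriv] x(2) by simp
  with r have "spin_ratio ?p (?r * x) \<le> x"
    by (simp add: zero_le_mult_iff)
  with r xy have "spin_ratio ?p (?r * x) / (?r * x) \<le> x / (?r * x)"
    by (intro divide_right_mono) auto
  also have "x / (?r * x) = 1 / ?r"
    using xy by simp
  finally have le: "spin_ratio ?p (?r * x) / (?r * x) \<le> 1 / ?r" .
  have "spin_ratio ?p (?r * y) / (?r * y) < spin_ratio ?p (?r * x) / (?r * x)"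
    using mult_pos_pos[OF r xy(1)] mult_strict_left_mono[OF xy(2) r]
    by (intro spin_ratio_over_self_decreasing spin_second_moment_bounds \<beta>)
  from this le have "spin_ratio ?p (?r * y) / (?r * y) < 1 / ?r"
    by (rule order_less_le_trans)
  moreover have "0 < ?r * y" using r xy by simp
  ultimately have "spin_ratio ?p (?r * y) < 1 / ?r * (?r * y)"
    by (simp only: pos_divide_less_eq)
  also have "1 / ?r * (?r * y) = y"
    using \<beta> K by simp
  finally have "spin_ratio ?p (?r * y) < y" .
  then show ?thesis
    using r DERIV_unique[OF y free_energy_deriv] by simp
qed

text \<open>
  Quasiconvexity is the only trace of the shape of the free energy that survives rescaling and is
  needed in the limit: it lets values at finitely many points control whole intervals.
\<close>
definition quasiconvex_halfline :: "(real \<Rightarrow> real) \<Rightarrow> bool" where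
  "quasiconvex_halfline f \<longleftrightarrow>
     (\<forall>a b c. 0 \<le> a \<longrightarrow> a \<le> b \<longrightarrow> b \<le> c \<longrightarrow> f b \<le> max (f a) (f c))"

text \<open>
  By the mean value theorem a violation would produce a point of nonnegative derivative followed by
  one of negative derivative.
\<close>
lemma free_energy_quasiconvex:
  assumes \<beta>: "0 < \<beta>" "\<beta> < beta_crit" and K: "0 < K"
  shows "quasiconvex_halfline (free_energy \<beta> K)"
  unfolding quasiconvex_halfline_def
proof (intro allI impI, rule ccontr)
  fix a b c :: real
  assume abc: "0 \<le> a" "a \<le> b" "b \<le> c" and "\<not> free_energy \<beta> K b \<le> max (free_energy \<beta> K a) (free_energy \<beta> K c)"
  then have up: "free_energy \<beta> K a < free_energy \<beta> K b" and down: "free_energy \<beta> K c < free_energy \<beta> K b"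
    by auto
  then have ab: "a < b" and bc: "b < c"
    using abc by (auto simp: less_le)
  define D where "D x = 2 * \<beta> * K * (x - spin_ratio (spin_second_moment \<beta>) (2 * \<beta> * K * x))" for x
  have D: "(free_energy \<beta> K has_real_derivative D x) (at x)" for x
    unfolding D_def by (rule free_energy_deriv)
  obtain u where u: "a < u" "u < b" "free_energy \<beta> K b - free_energy \<beta> K a = (b - a) * D u"
    using MVT2[OF ab, of "free_energy \<beta> K" D] D by blast
  obtain v where v: "b < v" "v < c" "free_energy \<beta> K c - free_energy \<beta> K b = (c - b) * D v"
    using MVT2[OF bc, of "free_energy \<beta> K" D] D by blast
  have "0 < (b - a) * D u" "(c - b) * D v < 0"
    using up down u v by linarith+
  then have "0 \<le> D u" "D v < 0"
    using ab bc by (auto simp: zero_less_mult_iff mult_less_0_iff)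
  moreover have "0 < D v"
    using free_energy_deriv_sign_change[OF \<beta> K _ _ D _ D, of u v] u v abc \<open>0 \<le> D u\<close> by auto
  ultimately show False by simp
qed

lemma positive_global_min_unique:
  assumes \<beta>: "0 < \<beta>" "\<beta> < beta_crit" and K: "0 < K"
    and x: "0 < x" "x \<in> global_min_points (free_energy \<beta> K)"
    and y: "0 < y" "y \<in> global_min_points (free_energy \<beta> K)"
  shows "x = y"
proof -
  have crit: "(free_energy \<beta> K has_real_derivative 0) (at z)" if "z \<in> global_min_points (free_energy \<beta> K)" for z
  proof -
    have "2 * \<beta> * K * (z - spin_ratio (spin_second_moment \<beta>) (2 * \<beta> * K * z)) = 0"
      by (rule DERIV_local_min[OF free_energy_deriv zero_less_one])
         (use that in \<open>auto simp: global_min_points_def\<close>)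
    with free_energy_deriv[of \<beta> K z] show ?thesis by metis
  qed
  show ?thesis
    using free_energy_deriv_sign_change[OF \<beta> K _ _ crit _ crit, of x y]
      free_energy_deriv_sign_change[OF \<beta> K _ _ crit _ crit, of y x] x y
    by (cases x y rule: linorder_cases) auto
qed

text \<open>
  The minimum over a large interval is a global minimum by coercivity. It is not at \<open>0\<close>, and evenness
  makes it positive.
\<close>
lemma positive_global_min_exists:
  fixes f :: "real \<Rightarrow> real"
  assumes cont: "continuous_on UNIV f" and even: "\<And>x. f \<bar>x\<bar> = f x"
    and neg: "f x0 < f 0" and coercive: "0 < c" "\<And>x. c * x\<^sup>2 - B \<le> f x"
  shows "\<exists>m>0. m \<in> global_min_points f"
proof -
  define R where "R = \<bar>x0\<bar> + (\<bar>f x0\<bar> + \<bar>B\<bar>) / c + 1"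
  have R: "1 \<le> R" "\<bar>x0\<bar> \<le> R" "(\<bar>f x0\<bar> + \<bar>B\<bar>) / c \<le> R"
    unfolding R_def using coercive by auto
  have far: "f x0 \<le> f x" if "R \<le> \<bar>x\<bar>" for x
  proof -
    have "\<bar>f x0\<bar> + \<bar>B\<bar> \<le> c * R"
      using R(3) coercive(1) by (simp add: pos_divide_le_eq mult.commute)
    also have "\<dots> \<le> c * x\<^sup>2"
    proof (rule mult_left_mono)
      have "R * 1 \<le> \<bar>x\<bar> * \<bar>x\<bar>"
        using that R(1) by (intro mult_mono) auto
      then show "R \<le> x\<^sup>2" by (simp add: power2_eq_square)
    qed (use coercive in simp)
    finally show ?thesis using coercive(2)[of x] by linarith
  qed
  obtain m where m: "m \<in> {-R..R}" "\<And>x. x \<in> {-R..R} \<Longrightarrow> f m \<le> f x"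
    using continuous_attains_inf[of "{-R..R}" f] R(1) continuous_on_subset[OF cont, of "{-R..R}"]
    by force
  have "f m \<le> f x0" using R by (intro m(2)) auto
  then have "f m \<le> f x" for x
    using m(2)[of x] far[of x] by (cases "R \<le> \<bar>x\<bar>") (auto simp: abs_le_iff not_le abs_less_iff)
  moreover have "m \<noteq> 0" using \<open>f m \<le> f x0\<close> neg by auto
  ultimately show ?thesis
    by (intro exI[of _ "\<bar>m\<bar>"]) (auto simp: global_min_points_def even)
qed

lemma magnetization_eq:
  assumes \<beta>: "0 < \<beta>" "\<beta> < beta_crit" and K: "0 < K"
    and m: "0 < m" "m \<in> global_min_points (free_energy \<beta> K)"
  shows "magnetization \<beta> K = m"
  unfolding magnetization_def positive_min_point_def
  using positive_global_min_unique[OF \<beta> K] m by (intro the_equality) auto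

section \<open>The free energy on the critical scale\<close>

text \<open>
  A quasiconvex function that is smaller at \<open>l \<le> r\<close> than at the outer points \<open>a < l\<close> and \<open>b > r\<close>
  cannot come down again beyond \<open>a\<close> or \<open>b\<close>. This replaces uniform convergence in the two limit
  arguments that follow.
\<close>
lemma quasiconvex_ge_outside:
  assumes f: "quasiconvex_halfline f" and abcd: "0 < a" "a < l" "l \<le> r" "r < b"
    and sep: "f l < f a" "f r < f b" "h \<le> f a" "h \<le> f b"
    and y: "0 \<le> y" "y \<le> a \<or> b \<le> y"
  shows "h \<le> f y"
  using y(2)
proof
  assume "y \<le> a"
  then have "f a \<le> max (f y) (f l)"
    using f y abcd unfolding quasiconvex_halfline_def by auto
  with sep show ?thesis by auto
next
  assume "b \<le> y"
  then have "f b \<le> max (f r) (f y)"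
    using f y abcd unfolding quasiconvex_halfline_def by auto
  with sep show ?thesis by auto
qed

text \<open>
  A minimum point away from \<open>x\<close> would have a value above that at \<open>x\<close>, because \<open>f n\<close> is eventually
  larger at \<open>x - d\<close> and \<open>x + d\<close> than at \<open>x\<close>.
\<close>
lemma quasiconvex_minimizer_tendsto:
  fixes f :: "nat \<Rightarrow> real \<Rightarrow> real"
  assumes qc: "\<forall>\<^sub>F n in sequentially. quasiconvex_halfline (f n)"
    and lim: "\<And>y. (\<lambda>n. f n y) \<longlonglongrightarrow> g y"
    and x: "0 < x" "\<And>y. 0 \<le> y \<Longrightarrow> y \<noteq> x \<Longrightarrow> g x < g y"
    and m: "\<forall>\<^sub>F n in sequentially. 0 < m n \<and> m n \<in> global_min_points (f n)"
  shows "m \<longlonglongrightarrow> x"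
proof (rule tendstoI)
  fix e :: real assume "0 < e"
  \<comment> \<open>Capping at \<open>x / 2\<close> keeps the test point \<open>x - d\<close> inside the positive half-line.\<close>
  define d where "d = min e (x / 2)"
  have d: "0 < d" "d < x" "d \<le> e" using \<open>0 < e\<close> x by (auto simp: d_def)
  have less: "\<forall>\<^sub>F n in sequentially. f n x < f n y" if "0 \<le> y" "y \<noteq> x" for y
  proof -
    have "(\<lambda>n. f n y - f n x) \<longlonglongrightarrow> g y - g x"
      by (intro tendsto_diff lim)
    from order_tendstoD(1)[OF this, of 0] x(2)[OF that] show ?thesis by simp
  qed
  have "\<forall>\<^sub>F n in sequentially. f n x < f n (x - d)" "\<forall>\<^sub>F n in sequentially. f n x < f n (x + d)"
    using less[of "x - d"] less[of "x + d"] d x(1) by auto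
  with qc m show "\<forall>\<^sub>F n in sequentially. dist (m n) x < e"
  proof eventually_elim
    case (elim n)
    then have m_pos: "0 \<le> m n" by simp
    have "\<not> (m n \<le> x - d \<or> x + d \<le> m n)"
    proof
      assume "m n \<le> x - d \<or> x + d \<le> m n"
      with elim(3,4) d m_pos have "min (f n (x - d)) (f n (x + d)) \<le> f n (m n)"
        by - (rule quasiconvex_ge_outside[OF elim(1), of "x - d" x x "x + d"], auto)
      moreover have "f n (m n) \<le> f n x"
        using elim by (auto simp: global_min_points_def)
      ultimately show False using elim by auto
    qed
    with d show ?case by (auto simp: dist_real_def)
  qed
qed

text \<open>
  With \<open>w\<^sup>2 = - a / (2 c)\<close> the polynomial is \<open>c (y\<^sup>2 - w\<^sup>2)\<^sup>2\<close> up to a constant.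
\<close>
lemma double_well_unique_min:
  fixes a c :: real
  assumes "a < 0" "0 < c" and g: "\<And>y. g y = a * y\<^sup>2 + c * y ^ 4"
  shows "0 < positive_min_point g"
    and "\<And>y. 0 \<le> y \<Longrightarrow> y \<noteq> positive_min_point g \<Longrightarrow> g (positive_min_point g) < g y"
proof -
  define w where "w = sqrt (- a / (2 * c))"
  have "0 < - a / (2 * c)"
    using assms by (intro divide_pos_pos) auto
  then have w: "0 < w" and w2: "w\<^sup>2 = - a / (2 * c)"
    unfolding w_def by (simp_all only: real_sqrt_gt_0_iff real_sqrt_pow2 less_imp_le)
  from w2 assms have a: "a = - (2 * c * w\<^sup>2)" by (simp add: field_simps)
  have diff: "g y - g w = c * (y\<^sup>2 - w\<^sup>2)\<^sup>2" for y
    unfolding g a by algebra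
  have strict: "g w < g y" if "0 \<le> y" "y \<noteq> w" for y
  proof -
    have "y\<^sup>2 \<noteq> w\<^sup>2" using that w by (auto simp: power2_eq_iff)
    then have "0 < c * (y\<^sup>2 - w\<^sup>2)\<^sup>2" using assms by simp
    with diff[of y] show ?thesis by simp
  qed
  have "g w \<le> g y" for y
    using diff[of y] assms by (smt (verit) mult_nonneg_nonneg zero_le_power2)
  with w strict have "positive_min_point g = w"
    unfolding positive_min_point_def global_min_points_def
    by (intro the_equality) (auto, meson leD less_imp_le)
  with w strict show "0 < positive_min_point g"
    "\<And>y. 0 \<le> y \<Longrightarrow> y \<noteq> positive_min_point g \<Longrightarrow> g (positive_min_point g) < g y"
    by auto
qed

text \<open>
  A quotient growing quadratically at first and then linearly with slope \<open>c / \<eta>\<close> dominates the line of slope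
  \<open>M\<close> up to a constant that does not depend on \<open>\<eta>\<close>, as long as that slope is at least \<open>2 M\<close>. The proof
  multiplies out and completes a square.
\<close>
lemma quartic_growth:
  fixes c M z \<eta> :: real
  assumes c: "0 < c" and \<eta>: "0 \<le> \<eta>" "\<eta> * M \<le> c / 2" and z: "0 \<le> z"
  shows "M * z - 2 * M\<^sup>2 / c \<le> c * z\<^sup>2 / (2 + \<eta> * z)"
proof -
  have pos: "0 < 2 + \<eta> * z" using \<eta> z by (simp add: add_pos_nonneg)
  have "0 \<le> c / 2 * (z - 2 * M / c)\<^sup>2" "0 \<le> 2 * M\<^sup>2 / c * (\<eta> * z)"
    using c \<eta> z by auto
  moreover have "c / 2 * (z - 2 * M / c)\<^sup>2 = c / 2 * z\<^sup>2 - 2 * M * z + 2 * M\<^sup>2 / c"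
    using c by (simp add: power2_eq_square field_simps)
  moreover have "\<eta> * M * z\<^sup>2 \<le> c / 2 * z\<^sup>2"
    using \<eta> by (intro mult_right_mono) auto
  moreover have "(M * z - 2 * M\<^sup>2 / c) * (2 + \<eta> * z)
      = 2 * M * z + \<eta> * M * z\<^sup>2 - 2 * (2 * M\<^sup>2 / c) - 2 * M\<^sup>2 / c * (\<eta> * z)"
    by (simp add: power2_eq_square algebra_simps add_divide_distrib)
  moreover have "0 \<le> 2 * M\<^sup>2 / c" using c by simp
  ultimately have "(M * z - 2 * M\<^sup>2 / c) * (2 + \<eta> * z) \<le> c * z\<^sup>2"
    by linarith
  with pos show ?thesis by (simp add: pos_le_divide_eq)
qed

definition scaled_energy :: "real \<Rightarrow> real \<Rightarrow> real \<Rightarrow> real \<Rightarrow> real" where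
  "scaled_energy \<beta> K \<epsilon> y = free_energy \<beta> K (\<epsilon> * y) / \<epsilon> ^ 4"

lemma scaled_energy_abs: "scaled_energy \<beta> K \<epsilon> \<bar>y\<bar> = scaled_energy \<beta> K \<epsilon> y"
proof -
  have "free_energy \<beta> K (\<epsilon> * \<bar>y\<bar>) = free_energy \<beta> K \<bar>\<epsilon> * \<bar>y\<bar>\<bar>"
    by (rule free_energy_abs[symmetric])
  also have "\<bar>\<epsilon> * \<bar>y\<bar>\<bar> = \<bar>\<epsilon> * y\<bar>"
    by (simp add: abs_mult)
  finally show ?thesis by (simp add: scaled_energy_def)
qed

lemma continuous_on_scaled_energy: "continuous_on A (scaled_energy \<beta> K \<epsilon>)"
  unfolding scaled_energy_def[abs_def] divide_inverse
  by (intro continuous_intros continuous_on_compose2[OF continuous_on_free_energy[of UNIV]]) auto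

lemma scaled_energy_quasiconvex:
  assumes "0 < \<beta>" "\<beta> < beta_crit" "0 < K" "0 < \<epsilon>"
  shows "quasiconvex_halfline (scaled_energy \<beta> K \<epsilon>)"
  unfolding quasiconvex_halfline_def
proof (intro allI impI)
  fix a b c :: real assume abc: "0 \<le> a" "a \<le> b" "b \<le> c"
  have "free_energy \<beta> K (\<epsilon> * b) \<le> max (free_energy \<beta> K (\<epsilon> * a)) (free_energy \<beta> K (\<epsilon> * c))"
    using free_energy_quasiconvex[OF assms(1-3)] abc assms(4)
    unfolding quasiconvex_halfline_def by (auto simp: mult_left_mono)
  moreover have "0 < \<epsilon> ^ 4" using assms by simp
  ultimately show "scaled_energy \<beta> K \<epsilon> b \<le> max (scaled_energy \<beta> K \<epsilon> a) (scaled_energy \<beta> K \<epsilon> c)"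
    unfolding scaled_energy_def by (auto simp: le_max_iff_disj divide_right_mono)
qed

lemma global_min_points_scaled_energy:
  assumes "0 < \<epsilon>"
  shows "y \<in> global_min_points (scaled_energy \<beta> K \<epsilon>) \<longleftrightarrow> \<epsilon> * y \<in> global_min_points (free_energy \<beta> K)"
proof -
  have "(\<forall>z. free_energy \<beta> K (\<epsilon> * y) \<le> free_energy \<beta> K (\<epsilon> * z))
      \<longleftrightarrow> (\<forall>x. free_energy \<beta> K (\<epsilon> * y) \<le> free_energy \<beta> K x)"
  proof (intro iffI allI)
    fix x assume "\<forall>z. free_energy \<beta> K (\<epsilon> * y) \<le> free_energy \<beta> K (\<epsilon> * z)"
    from this[rule_format, of "x / \<epsilon>"] assms show "free_energy \<beta> K (\<epsilon> * y) \<le> free_energy \<beta> K x"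
      by simp
  qed auto
  with assms show ?thesis
    by (simp add: global_min_points_def scaled_energy_def divide_le_cancel)
qed

text \<open>
  A sequence of parameters converging to a point of the second-order curve, observed at length scale
  \<open>\<epsilon>s\<close>; \<open>L\<close> is the resulting quadratic coefficient of the limiting polynomial. The cases \<open>L < 0\<close> and
  \<open>L = 0\<close> both occur, depending on how the scale compares with the distance to the curve.
\<close>
locale critical_scaling =
  fixes \<beta> L :: real and \<beta>s Ks \<epsilon>s :: "nat \<Rightarrow> real"
  assumes \<beta>: "0 < \<beta>" "\<beta> < beta_crit"
    and \<beta>s: "\<beta>s \<longlonglongrightarrow> \<beta>" and Ks: "Ks \<longlonglongrightarrow> K_curve \<beta>"
    and \<epsilon>s: "\<epsilon>s \<longlonglongrightarrow> 0" and \<epsilon>s_pos: "\<forall>\<^sub>F n in sequentially. 0 < \<epsilon>s n"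
    and L: "(\<lambda>n. quadratic_coeff (\<beta>s n) (Ks n) / (\<epsilon>s n)\<^sup>2) \<longlonglongrightarrow> L"
begin

abbreviation f :: "nat \<Rightarrow> real \<Rightarrow> real" where
  "f n \<equiv> scaled_energy (\<beta>s n) (Ks n) (\<epsilon>s n)"

definition landau :: "real \<Rightarrow> real" where
  "landau y = L * y\<^sup>2 + c4 \<beta> * y ^ 4"

lemma c4_pos: "0 < c4 \<beta>"
proof -
  have "exp \<beta> < 4"
    using \<beta> unfolding beta_crit_def by (metis exp_less_cancel_iff exp_ln zero_less_numeral)
  moreover have "0 < exp \<beta> + 2" by (simp add: add_pos_pos)
  ultimately show ?thesis unfolding c4_def by simp
qed

lemma K_curve_pos: "0 < K_curve \<beta>"
  using \<beta> unfolding K_curve_def by (simp add: add_pos_pos)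

lemma eventually_admissible:
  "\<forall>\<^sub>F n in sequentially. 0 < \<beta>s n \<and> \<beta>s n < beta_crit \<and> 0 < Ks n \<and> 0 < \<epsilon>s n"
  using order_tendstoD[OF \<beta>s] order_tendstoD(1)[OF Ks K_curve_pos] \<epsilon>s_pos \<beta>
  by (auto intro!: eventually_conj)

abbreviation p :: real where "p \<equiv> spin_second_moment \<beta>"

abbreviation ps :: "nat \<Rightarrow> real" where "ps n \<equiv> spin_second_moment (\<beta>s n)"

lemma p_bounds: "1/3 < p" "p \<le> 1"
  using spin_second_moment_bounds \<beta> by auto

lemma ps_limit: "ps \<longlonglongrightarrow> p"
  unfolding spin_second_moment_def
  by (intro tendsto_intros \<beta>s) (simp add: add_pos_pos less_imp_neq[symmetric])

lemma slope_limit: "(\<lambda>n. 2 * \<beta>s n * Ks n) \<longlonglongrightarrow> 1 / p"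
proof -
  have "(\<lambda>n. 2 * \<beta>s n * Ks n) \<longlonglongrightarrow> 2 * \<beta> * K_curve \<beta>"
    by (intro tendsto_intros \<beta>s Ks)
  also have "2 * \<beta> * K_curve \<beta> = 1 / p"
    using \<beta> by (simp add: K_curve_def spin_second_moment_def)
  finally show ?thesis .
qed

lemma f_split:
  assumes "0 < \<epsilon>s n"
  shows "f n y = quadratic_coeff (\<beta>s n) (Ks n) / (\<epsilon>s n)\<^sup>2 * y\<^sup>2
            + quartic_part (ps n) (2 * \<beta>s n * Ks n * (\<epsilon>s n * y)) / \<epsilon>s n ^ 4"
  using assms unfolding scaled_energy_def free_energy_split
  by (simp add: add_divide_distrib power_mult_distrib power2_eq_square power4_eq_xxxx)

lemma f_limit: "(\<lambda>n. f n y) \<longlonglongrightarrow> landau y"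
proof (cases "y = 0")
  case True
  then show ?thesis by (simp add: scaled_energy_def landau_def)
next
  case False
  define t where "t n = 2 * \<beta>s n * Ks n * (\<epsilon>s n * y)" for n
  have "t \<longlonglongrightarrow> 1 / p * (0 * y)"
    unfolding t_def by (intro tendsto_mult slope_limit \<epsilon>s tendsto_const)
  moreover have "\<forall>\<^sub>F n in sequentially. t n \<noteq> 0"
    using eventually_admissible by eventually_elim (simp add: t_def False)
  ultimately have t: "filterlim t (at 0) sequentially"
    by (simp add: filterlim_at)
  have "(\<lambda>n. quadratic_coeff (\<beta>s n) (Ks n) / (\<epsilon>s n)\<^sup>2 * y\<^sup>2
      + quartic_part (ps n) (t n) / t n ^ 4 * (2 * \<beta>s n * Ks n * y) ^ 4)
      \<longlonglongrightarrow> L * y\<^sup>2 + p * (3 * p - 1) / 24 * (1 / p * y) ^ 4"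
    using p_bounds by (intro tendsto_intros L slope_limit quartic_part_limit ps_limit t) auto
  also have "p * (3 * p - 1) / 24 * (1 / p * y) ^ 4 = c4 \<beta> * y ^ 4"
  proof -
    have E: "exp \<beta> + 2 \<noteq> 0"
      using add_pos_pos[OF exp_gt_zero[of \<beta>], of 2] by simp
    then have A: "3 * p - 1 = (4 - exp \<beta>) / (exp \<beta> + 2)"
      by (simp add: spin_second_moment_def divide_simps)
    have B: "2 / E * (q / E) / 24 * (1 / (2 / E)) ^ 4 = E\<^sup>2 * q / 192" if "E \<noteq> 0" for E q :: real
      using that by (simp add: field_simps power2_eq_square power4_eq_xxxx)
    have "8 * fact 4 = (192 :: real)"
      by (simp add: fact_numeral)
    then have "p * (3 * p - 1) / 24 * (1 / p) ^ 4 = c4 \<beta>"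
      unfolding A unfolding c4_def spin_second_moment_def by (simp only: B[OF E])
    then show ?thesis by (simp only: power_mult_distrib mult.assoc[symmetric])
  qed
  finally have "(\<lambda>n. quadratic_coeff (\<beta>s n) (Ks n) / (\<epsilon>s n)\<^sup>2 * y\<^sup>2
      + quartic_part (ps n) (t n) / t n ^ 4 * (2 * \<beta>s n * Ks n * y) ^ 4) \<longlonglongrightarrow> landau y"
    unfolding landau_def .
  then show ?thesis
  proof (rule Lim_transform_eventually)
    show "\<forall>\<^sub>F n in sequentially. quadratic_coeff (\<beta>s n) (Ks n) / (\<epsilon>s n)\<^sup>2 * y\<^sup>2
      + quartic_part (ps n) (t n) / t n ^ 4 * (2 * \<beta>s n * Ks n * y) ^ 4 = f n y"
      using eventually_admissible
    proof eventually_elim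
      case (elim n)
      have "t n ^ 4 = (2 * \<beta>s n * Ks n * y) ^ 4 * \<epsilon>s n ^ 4"
        by (simp add: t_def power_mult_distrib)
      moreover have "(2 * \<beta>s n * Ks n * y) ^ 4 \<noteq> 0"
        using elim False by simp
      moreover have "a / (w * c) * w = a / c" if "w \<noteq> 0" for a c w :: real
        using that by simp
      ultimately have "quartic_part (ps n) (t n) / t n ^ 4 * (2 * \<beta>s n * Ks n * y) ^ 4
          = quartic_part (ps n) (t n) / \<epsilon>s n ^ 4"
        by presburger
      with elim show ?case by (simp add: f_split t_def)
    qed
  qed
qed

text \<open>
  The quadratic coefficient is eventually at least \<open>- (\<bar>L\<bar> + 1)\<close>. The rescaled remainder is eventually
  at least \<open>c y ^ 4 / (2 + \<eta> y\<^sup>2)\<close>, where \<open>\<eta>\<close> can be taken arbitrarily small because \<open>\<epsilon>s\<close> tends to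
  \<open>0\<close>, so by \<open>quartic_growth\<close> it beats any multiple of \<open>y\<^sup>2\<close>. The bound supplies both the coercivity
  that makes minimum points exist and the integrable majorant for the Gibbs means.
\<close>
lemma f_lower_bound: "\<exists>B. \<forall>\<^sub>F n in sequentially. \<forall>y. y\<^sup>2 - B \<le> f n y"
proof -
  define C where "C n = ps n * (ps n - 1/3) / 4 * (2 * \<beta>s n * Ks n) ^ 4" for n
  define c where "c = p * (p - 1/3) / 4 * (1 / p) ^ 4 / 2"
  define M where "M = \<bar>L\<bar> + 2"
  define \<eta> where "\<eta> = c / (2 * M)"
  have c: "0 < c" unfolding c_def using p_bounds by (intro mult_pos_pos divide_pos_pos) auto
  have M: "0 < M" by (simp add: M_def)
  have \<eta>: "0 < \<eta>" "\<eta> * M = c / 2" using c M by (auto simp: \<eta>_def)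
  have "C \<longlonglongrightarrow> p * (p - 1/3) / 4 * (1 / p) ^ 4"
    unfolding C_def by (intro tendsto_intros ps_limit slope_limit) auto
  moreover have "p * (p - 1/3) / 4 * (1 / p) ^ 4 = 2 * c" by (simp add: c_def)
  ultimately have evC: "\<forall>\<^sub>F n in sequentially. c < C n"
    using c by (intro order_tendstoD(1)[of C "2 * c"]) auto
  have "(\<lambda>n. (2 * \<beta>s n * Ks n * \<epsilon>s n)\<^sup>2) \<longlonglongrightarrow> (1 / p * 0)\<^sup>2"
    by (intro tendsto_intros slope_limit \<epsilon>s)
  then have ev\<eta>: "\<forall>\<^sub>F n in sequentially. (2 * \<beta>s n * Ks n * \<epsilon>s n)\<^sup>2 < \<eta>"
    using \<eta> by (intro order_tendstoD(2)[where y = 0]) auto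
  have evL: "\<forall>\<^sub>F n in sequentially. - (\<bar>L\<bar> + 1) < quadratic_coeff (\<beta>s n) (Ks n) / (\<epsilon>s n)\<^sup>2"
    by (rule order_tendstoD(1)[OF L]) (simp add: abs_if)
  have evp: "\<forall>\<^sub>F n in sequentially. 1/3 < ps n \<and> ps n \<le> 1"
    using eventually_admissible by eventually_elim (use spin_second_moment_bounds in blast)
  have "\<forall>\<^sub>F n in sequentially. \<forall>y. y\<^sup>2 - 2 * M\<^sup>2 / c \<le> f n y"
    using eventually_admissible evC ev\<eta> evL evp
  proof eventually_elim
    case (elim n)
    show ?case
    proof
      fix y :: real
      define r where "r = 2 * \<beta>s n * Ks n"
      have "M * y\<^sup>2 - 2 * M\<^sup>2 / c \<le> c * (y\<^sup>2)\<^sup>2 / (2 + \<eta> * y\<^sup>2)"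
        using c \<eta> by (intro quartic_growth) auto
      also have "\<dots> \<le> C n * (y\<^sup>2)\<^sup>2 / (2 + (r * \<epsilon>s n)\<^sup>2 * y\<^sup>2)"
        using elim c \<eta> unfolding r_def
        by (intro frac_le mult_right_mono add_left_mono) (auto intro!: add_pos_nonneg)
      also have "\<dots> = ps n * (ps n - 1/3) / 4 * ((r * (\<epsilon>s n * y)) ^ 4 / (2 + (r * (\<epsilon>s n * y))\<^sup>2)) / \<epsilon>s n ^ 4"
        using elim by (simp add: C_def r_def power_mult_distrib mult_ac flip: power_mult)
      also have "\<dots> \<le> quartic_part (ps n) (r * (\<epsilon>s n * y)) / \<epsilon>s n ^ 4"
        using elim by (intro divide_right_mono quartic_part_ge) auto
      finally have 1: "M * y\<^sup>2 - 2 * M\<^sup>2 / c \<le> quartic_part (ps n) (r * (\<epsilon>s n * y)) / \<epsilon>s n ^ 4" .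
      have "- (\<bar>L\<bar> + 1) * y\<^sup>2 \<le> quadratic_coeff (\<beta>s n) (Ks n) / (\<epsilon>s n)\<^sup>2 * y\<^sup>2"
        using elim by (intro mult_right_mono) auto
      with 1 have "- (\<bar>L\<bar> + 1) * y\<^sup>2 + (M * y\<^sup>2 - 2 * M\<^sup>2 / c) \<le> f n y"
        using elim by (simp add: f_split r_def)
      moreover have "- (\<bar>L\<bar> + 1) * y\<^sup>2 + M * y\<^sup>2 = y\<^sup>2"
        by (simp add: M_def algebra_simps)
      ultimately show "y\<^sup>2 - 2 * M\<^sup>2 / c \<le> f n y" by linarith
    qed
  qed
  then show ?thesis by blast
qed

text \<open>
  The rescaled energy is eventually negative at the minimum point of the limiting polynomial, so it
  has a positive global minimum point, which by uniqueness is the rescaled magnetization.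
\<close>
lemma magnetization_limit:
  assumes neg: "L < 0"
  shows "(\<lambda>n. magnetization (\<beta>s n) (Ks n) / \<epsilon>s n) \<longlonglongrightarrow> positive_min_point landau"
proof -
  let ?x = "positive_min_point landau"
  note x = double_well_unique_min[OF neg c4_pos landau_def]
  obtain B where B: "\<forall>\<^sub>F n in sequentially. \<forall>y. y\<^sup>2 - B \<le> f n y"
    using f_lower_bound by blast
  have "landau ?x < landau 0"
    using x(1) by (intro x(2)) auto
  then have "landau ?x < 0"
    by (simp add: landau_def[of 0])
  with f_limit[of ?x] have neg_f: "\<forall>\<^sub>F n in sequentially. f n ?x < 0"
    by (rule order_tendstoD(2))
  have m: "\<forall>\<^sub>F n in sequentially. 0 < magnetization (\<beta>s n) (Ks n) / \<epsilon>s n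
      \<and> magnetization (\<beta>s n) (Ks n) / \<epsilon>s n \<in> global_min_points (f n)"
    using eventually_admissible B neg_f
  proof eventually_elim
    case (elim n)
    have "f n ?x < f n 0" using elim by (simp add: scaled_energy_def)
    then obtain m where m: "0 < m" "m \<in> global_min_points (f n)"
      using positive_global_min_exists[of "f n" ?x 1 B] elim
      by (auto simp: continuous_on_scaled_energy scaled_energy_abs)
    then have "magnetization (\<beta>s n) (Ks n) = \<epsilon>s n * m"
      using elim by (intro magnetization_eq) (auto simp: global_min_points_scaled_energy)
    with m elim show ?case by simp
  qed
  have "\<forall>\<^sub>F n in sequentially. quasiconvex_halfline (f n)"
    using eventually_admissible by eventually_elim (simp add: scaled_energy_quasiconvex)
  from quasiconvex_minimizer_tendsto[OF this f_limit x m] show ?thesis .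
qed

end

section \<open>Limits of Gibbs means\<close>

lemma integrable_abs_gaussian:
  "integrable lborel (\<lambda>x::real. exp (- x\<^sup>2))" "integrable lborel (\<lambda>x::real. \<bar>x\<bar> * exp (- x\<^sup>2))"
proof -
  define s :: real where "s = 1 / sqrt 2"
  have s: "0 < s" by (simp add: s_def)
  have eq: "exp (- x\<^sup>2) = sqrt pi * normal_density 0 s x" for x :: real
    by (simp add: normal_density_def s_def power_divide)
  have "integrable lborel (\<lambda>x. sqrt pi * (normal_density 0 s x * (x - 0) ^ (2 * 0)))"
    using normal_moment_even[OF s, of 0 0] by (intro integrable_mult_right) (auto simp: has_bochner_integral_iff)
  then show "integrable lborel (\<lambda>x::real. exp (- x\<^sup>2))"
    by (simp add: eq)
  have "integrable lborel (\<lambda>x. sqrt pi * (normal_density 0 s x * \<bar>x - 0\<bar> ^ (2 * 0 + 1)))"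
    using normal_moment_abs_odd[OF s, of 0 0] by (intro integrable_mult_right) (auto simp: has_bochner_integral_iff)
  then show "integrable lborel (\<lambda>x::real. \<bar>x\<bar> * exp (- x\<^sup>2))"
    by (simp add: eq mult_ac)
qed

lemma integrable_gaussian_majorant:
  "integrable lborel (\<lambda>x::real. (a + \<bar>x\<bar>) * exp (B - x\<^sup>2))"
proof -
  have "integrable lborel (\<lambda>x::real. exp B * (a * exp (- x\<^sup>2) + \<bar>x\<bar> * exp (- x\<^sup>2)))"
    by (intro integrable_mult_right Bochner_Integration.integrable_add integrable_abs_gaussian)
  also have "(\<lambda>x::real. exp B * (a * exp (- x\<^sup>2) + \<bar>x\<bar> * exp (- x\<^sup>2)))
      = (\<lambda>x. (a + \<bar>x\<bar>) * exp (B - x\<^sup>2))"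
    by (simp add: fun_eq_iff algebra_simps exp_diff exp_minus divide_inverse)
  finally show ?thesis .
qed

lemma integrable_gibbs_weight:
  fixes f :: "real \<Rightarrow> real"
  assumes f: "continuous_on UNIV f" "\<And>y. y\<^sup>2 - B \<le> f y"
  shows "integrable lborel (\<lambda>y. exp (- f y))" "integrable lborel (\<lambda>y. \<bar>y\<bar> * exp (- f y))"
proof -
  have [measurable]: "f \<in> borel_measurable borel"
    using f(1) by (rule borel_measurable_continuous_onI)
  have "exp (- f y) \<le> exp (B - y\<^sup>2)" for y
    using f(2)[of y] by simp
  then have "norm (exp (- f y)) \<le> norm ((1 + \<bar>y\<bar>) * exp (B - y\<^sup>2))"
    "norm (\<bar>y\<bar> * exp (- f y)) \<le> norm ((1 + \<bar>y\<bar>) * exp (B - y\<^sup>2))" for y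
    using mult_mono[of 1 "1 + \<bar>y\<bar>" "exp (- f y)" "exp (B - y\<^sup>2)"]
      mult_mono[of "\<bar>y\<bar>" "1 + \<bar>y\<bar>" "exp (- f y)" "exp (B - y\<^sup>2)"] by (auto simp: abs_mult)
  then show "integrable lborel (\<lambda>y. exp (- f y))" "integrable lborel (\<lambda>y. \<bar>y\<bar> * exp (- f y))"
    by (auto intro!: Bochner_Integration.integrable_bound[OF integrable_gaussian_majorant[of 1 B]])
qed

lemma lborel_integral_pos:
  fixes h :: "real \<Rightarrow> real"
  assumes "integrable lborel h" "\<And>x. 0 \<le> h x" "\<And>x. x \<noteq> 0 \<Longrightarrow> h x \<noteq> 0"
  shows "0 < (\<integral>x. h x \<partial>lborel)"
proof (rule ccontr)
  assume "\<not> ?thesis"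
  moreover have "0 \<le> (\<integral>x. h x \<partial>lborel)"
    using assms by (intro integral_nonneg_AE) auto
  ultimately have "(\<integral>x. h x \<partial>lborel) = 0" by simp
  then have "AE x in lborel. h x = 0"
    using assms by (subst (asm) integral_nonneg_eq_0_iff_AE) auto
  moreover have "AE x in lborel. x \<noteq> (0::real)"
    by (rule AE_lborel_singleton)
  ultimately have "AE x in lborel. x \<in> ({} :: real set)"
    by eventually_elim (use assms in auto)
  then have "emeasure lborel (UNIV :: real set) = 0"
    by (subst (asm) AE_iff_null) (auto simp: null_sets_def)
  then show False by simp
qed

text \<open>
  The common lower bound \<open>y\<^sup>2 - B\<close> makes a multiple of a Gaussian an integrable majorant of numerator
  and denominator. Positivity of the limit is what turns convergence into asymptotic equivalence later.
\<close>
lemma gibbs_abs_mean_tendsto: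
  fixes f :: "nat \<Rightarrow> real \<Rightarrow> real"
  assumes f: "\<And>n. continuous_on UNIV (f n)" and g: "continuous_on UNIV g"
    and lim: "\<And>y. (\<lambda>n. f n y) \<longlonglongrightarrow> g y"
    and lower: "\<forall>\<^sub>F n in sequentially. \<forall>y. y\<^sup>2 - B \<le> f n y"
  shows "(\<lambda>n. gibbs_abs_mean (f n)) \<longlonglongrightarrow> gibbs_abs_mean g" and "0 < gibbs_abs_mean g"
proof -
  obtain n0 where n0: "\<And>n y. n0 \<le> n \<Longrightarrow> y\<^sup>2 - B \<le> f n y"
    using lower by (auto simp: eventually_sequentially)
  have g_lower: "y\<^sup>2 - B \<le> g y" for y
    using lim[of y] by (rule LIMSEQ_le_const) (use n0 in blast)
  note [measurable] = borel_measurable_continuous_onI[OF f] borel_measurable_continuous_onI[OF g]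
  note int = integrable_gibbs_weight[OF g g_lower]
  have Zpos: "0 < (\<integral>y. exp (- g y) \<partial>lborel)"
    by (rule lborel_integral_pos[OF int(1)]) auto
  have Apos: "0 < (\<integral>y. \<bar>y\<bar> * exp (- g y) \<partial>lborel)"
    by (rule lborel_integral_pos[OF int(2)]) auto
  show "0 < gibbs_abs_mean g"
    unfolding gibbs_abs_mean_def using Zpos Apos by simp
  have bound: "exp (- f (n + n0) y) \<le> exp (B - y\<^sup>2)" for n y
    using n0[of "n + n0" y] by simp
  have "(\<lambda>n. \<integral>y. exp (- f (n + n0) y) \<partial>lborel) \<longlonglongrightarrow> (\<integral>y. exp (- g y) \<partial>lborel)"
  proof (rule integral_dominated_convergence[where w = "\<lambda>y. (1 + \<bar>y\<bar>) * exp (B - y\<^sup>2)"])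
    show "integrable lborel (\<lambda>y::real. (1 + \<bar>y\<bar>) * exp (B - y\<^sup>2))"
      by (rule integrable_gaussian_majorant)
    show "AE y in lborel. (\<lambda>n. exp (- f (n + n0) y)) \<longlonglongrightarrow> exp (- g y)"
      by (intro AE_I2 tendsto_intros LIMSEQ_ignore_initial_segment[OF lim])
    show "AE y in lborel. norm (exp (- f (n + n0) y)) \<le> (1 + \<bar>y\<bar>) * exp (B - y\<^sup>2)" for n
    proof (rule AE_I2)
      fix y :: real
      have "1 * exp (- f (n + n0) y) \<le> (1 + \<bar>y\<bar>) * exp (B - y\<^sup>2)"
        by (intro mult_mono bound) auto
      then show "norm (exp (- f (n + n0) y)) \<le> (1 + \<bar>y\<bar>) * exp (B - y\<^sup>2)"
        by simp
    qed
  qed auto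
  then have Z: "(\<lambda>n. \<integral>y. exp (- f n y) \<partial>lborel) \<longlonglongrightarrow> (\<integral>y. exp (- g y) \<partial>lborel)"
    by (rule LIMSEQ_offset)
  have "(\<lambda>n. \<integral>y. \<bar>y\<bar> * exp (- f (n + n0) y) \<partial>lborel) \<longlonglongrightarrow> (\<integral>y. \<bar>y\<bar> * exp (- g y) \<partial>lborel)"
  proof (rule integral_dominated_convergence[where w = "\<lambda>y. (0 + \<bar>y\<bar>) * exp (B - y\<^sup>2)"])
    show "integrable lborel (\<lambda>y::real. (0 + \<bar>y\<bar>) * exp (B - y\<^sup>2))"
      by (rule integrable_gaussian_majorant)
    show "AE y in lborel. (\<lambda>n. \<bar>y\<bar> * exp (- f (n + n0) y)) \<longlonglongrightarrow> \<bar>y\<bar> * exp (- g y)"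
      by (intro AE_I2 tendsto_intros LIMSEQ_ignore_initial_segment[OF lim])
    show "AE y in lborel. norm (\<bar>y\<bar> * exp (- f (n + n0) y)) \<le> (0 + \<bar>y\<bar>) * exp (B - y\<^sup>2)" for n
      using bound[of n] by (intro AE_I2) (auto simp: abs_mult intro!: mult_left_mono)
  qed auto
  then have A: "(\<lambda>n. \<integral>y. \<bar>y\<bar> * exp (- f n y) \<partial>lborel) \<longlonglongrightarrow> (\<integral>y. \<bar>y\<bar> * exp (- g y) \<partial>lborel)"
    by (rule LIMSEQ_offset)
  show "(\<lambda>n. gibbs_abs_mean (f n)) \<longlonglongrightarrow> gibbs_abs_mean g"
    unfolding gibbs_abs_mean_def using Zpos by (intro tendsto_divide A Z) auto
qed

lemma gibbs_abs_mean_scale: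
  assumes "0 < c"
  shows "gibbs_abs_mean (\<lambda>y. h (c * y)) = gibbs_abs_mean h / c"
proof -
  have "(\<integral>x. exp (- h x) \<partial>lborel) = c * (\<integral>x. exp (- h (c * x)) \<partial>lborel)"
    using lborel_integral_real_affine[of c "\<lambda>x. exp (- h x)" 0] assms by simp
  moreover have "(\<integral>x. \<bar>x\<bar> * exp (- h x) \<partial>lborel) = c * (c * (\<integral>x. \<bar>x\<bar> * exp (- h (c * x)) \<partial>lborel))"
    using lborel_integral_real_affine[of c "\<lambda>x. \<bar>x\<bar> * exp (- h x)" 0] assms
    by (simp add: abs_mult mult.assoc)
  ultimately show ?thesis
    unfolding gibbs_abs_mean_def using assms by simp
qed

text \<open>
  Let \<open>x\<close> be the strict minimum point of \<open>g\<close> on the half-line. Choose \<open>e\<close> and then \<open>d < e\<close> and \<open>\<eta>\<close>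
  such that \<open>f n\<close> is eventually above \<open>g x + 2 \<eta>\<close> at \<open>x \<plusminus> e\<close> and below \<open>g x + \<eta>\<close> at \<open>x \<plusminus> d\<close>.
  Quasiconvexity spreads these four pointwise bounds to \<open>\<bar>\<bar>y\<bar> - x\<bar> \<ge> e\<close> and to \<open>[x - d, x + d]\<close>. The
  mass outside the wells is then smaller than the normalising integral by a factor of order
  \<open>exp (- N \<eta>)\<close>.
\<close>
lemma gibbs_abs_mean_laplace:
  fixes f :: "nat \<Rightarrow> real \<Rightarrow> real" and N :: "nat \<Rightarrow> real"
  assumes qc: "\<forall>\<^sub>F n in sequentially. quasiconvex_halfline (f n)"
    and even: "\<And>n y. f n \<bar>y\<bar> = f n y"
    and f: "\<And>n. continuous_on UNIV (f n)" and g: "isCont g x"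
    and lim: "\<And>y. (\<lambda>n. f n y) \<longlonglongrightarrow> g y"
    and lower: "\<forall>\<^sub>F n in sequentially. \<forall>y. y\<^sup>2 - B \<le> f n y"
    and x: "0 < x" "\<And>y. 0 \<le> y \<Longrightarrow> y \<noteq> x \<Longrightarrow> g x < g y"
    and N: "filterlim N at_top sequentially"
  shows "(\<lambda>n. gibbs_abs_mean (\<lambda>y. N n * f n y)) \<longlonglongrightarrow> x"
proof (rule tendstoI)
  fix e0 :: real assume "0 < e0"
  define e where "e = min (e0 / 2) (x / 2)"
  have e: "0 < e" "e < x" "e < e0" using \<open>0 < e0\<close> x by (auto simp: e_def)
  define h where "h = min (g (x - e)) (g (x + e)) - g x"
  have h: "0 < h" using x(2)[of "x - e"] x(2)[of "x + e"] e x(1) by (auto simp: h_def)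
  define \<eta> where "\<eta> = h / 3"
  have \<eta>: "0 < \<eta>" "g x + 2 * \<eta> < g (x - e)" "g x + 2 * \<eta> < g (x + e)"
  proof -
    have "g x + h \<le> g (x - e)" "g x + h \<le> g (x + e)"
      by (auto simp: h_def)
    with h show "0 < \<eta>" "g x + 2 * \<eta> < g (x - e)" "g x + 2 * \<eta> < g (x + e)"
      by (auto simp: \<eta>_def)
  qed
  obtain d0 where d0: "0 < d0" "\<And>y. \<bar>y - x\<bar> < d0 \<Longrightarrow> \<bar>g y - g x\<bar> < \<eta>"
    using g \<eta>(1) unfolding continuous_at_eps_delta dist_real_def by blast
  define d where "d = min (d0 / 2) (e / 2)"
  have d: "0 < d" "d < e" "d < d0" using d0 e by (auto simp: d_def)
  have gd: "g (x - d) < g x + \<eta>" "g (x + d) < g x + \<eta>"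
    using d0(2)[of "x - d"] d0(2)[of "x + d"] d by auto
  define C where "C = (\<integral>y. (x + \<bar>y\<bar>) * exp (B - y\<^sup>2) \<partial>lborel)"
  have tail0: "(\<lambda>n. C / (2 * d) * exp (g x + 2 * \<eta>) * exp (- (N n * \<eta>))) \<longlonglongrightarrow> C / (2 * d) * exp (g x + 2 * \<eta>) * 0"
  proof (intro tendsto_mult tendsto_const)
    have "filterlim (\<lambda>n. N n * \<eta>) at_top sequentially"
      using filterlim_at_top_mult_tendsto_pos[OF tendsto_const \<eta>(1) N] .
    then have "filterlim (\<lambda>n. - (N n * \<eta>)) at_bot sequentially"
      by (simp add: filterlim_uminus_at_top)
    then show "(\<lambda>n. exp (- (N n * \<eta>))) \<longlonglongrightarrow> 0"
      by (rule filterlim_compose[OF exp_at_bot])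
  qed
  have small: "\<forall>\<^sub>F n in sequentially. C / (2 * d) * exp (g x + 2 * \<eta>) * exp (- (N n * \<eta>)) < e0 - e"
    using order_tendstoD(2)[OF tail0, of "e0 - e"] e by simp
  have "\<forall>\<^sub>F n in sequentially. 1 \<le> N n"
    using N by (simp add: filterlim_at_top)
  moreover note qc lower small
  moreover have "\<forall>\<^sub>F n in sequentially. g x + 2 * \<eta> < f n (x - e)" "\<forall>\<^sub>F n in sequentially. g x + 2 * \<eta> < f n (x + e)"
    by (rule order_tendstoD(1)[OF lim \<eta>(2)] order_tendstoD(1)[OF lim \<eta>(3)])+
  moreover have "\<forall>\<^sub>F n in sequentially. f n (x - d) < g x + \<eta>" "\<forall>\<^sub>F n in sequentially. f n (x + d) < g x + \<eta>"
    by (rule order_tendstoD(2)[OF lim gd(1)] order_tendstoD(2)[OF lim gd(2)])+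
  ultimately show "\<forall>\<^sub>F n in sequentially. dist (gibbs_abs_mean (\<lambda>y. N n * f n y)) x < e0"
  proof eventually_elim
    case (elim n)
    let ?F = "\<lambda>y. N n * f n y"
    let ?Z = "\<integral>y. exp (- ?F y) \<partial>lborel"
    let ?s = "exp (- ((N n - 1) * (g x + 2 * \<eta>)))"
    have N1: "1 \<le> N n" and low: "\<And>y. y\<^sup>2 - B \<le> f n y" using elim by auto
    have contF: "continuous_on UNIV ?F" by (intro continuous_intros f)
    have lowF: "y\<^sup>2 - N n * B \<le> ?F y" for y
    proof -
      have "y\<^sup>2 - N n * B \<le> N n * (y\<^sup>2 - B)"
        using mult_right_mono[OF N1, of "y\<^sup>2"] by (simp add: right_diff_distrib)
      also have "\<dots> \<le> ?F y" using N1 low by (intro mult_left_mono) auto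
      finally show ?thesis .
    qed
    note int = integrable_gibbs_weight[OF contF lowF]
    have far: "g x + 2 * \<eta> \<le> f n y" if "\<not> \<bar>\<bar>y\<bar> - x\<bar> < e" for y
    proof -
      have "g x + 2 * \<eta> \<le> f n \<bar>y\<bar>"
        by (rule quasiconvex_ge_outside[of "f n" "x - e" "x - d" "x + d" "x + e"])
           (use elim(2,5-8) that d e \<eta> in \<open>auto simp: abs_less_iff\<close>)
      then show ?thesis by (simp add: even)
    qed
    have near: "f n y \<le> g x + \<eta>" if "x - d \<le> y" "y \<le> x + d" for y
    proof -
      have "f n y \<le> max (f n (x - d)) (f n (x + d))"
        using elim(2) that d e unfolding quasiconvex_halfline_def by auto
      with elim(7,8) show ?thesis by linarith
    qed
    have Z: "2 * d * exp (- (N n * (g x + \<eta>))) \<le> ?Z"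
    proof -
      have "2 * d * exp (- (N n * (g x + \<eta>)))
          = (\<integral>y. indicator {x - d..x + d} y * exp (- (N n * (g x + \<eta>))) \<partial>lborel)"
        using d by simp
      also have "\<dots> \<le> ?Z"
      proof (rule integral_mono)
        show "indicator {x - d..x + d} y * exp (- (N n * (g x + \<eta>))) \<le> exp (- ?F y)" for y
          using mult_left_mono[OF near[of y], of "N n"] N1 by (auto simp: indicator_def)
      qed (use int in \<open>auto simp: integrable_indicator_iff emeasure_lborel_Icc_eq\<close>)
      finally show ?thesis .
    qed
    have Zpos: "0 < ?Z" using Z d by (smt (verit) exp_gt_zero mult_pos_pos)
    \<comment> \<open>Away from the wells only \<open>N n - 1\<close> of the \<open>N n\<close> factors of \<open>exp (- f n y)\<close> are used for the exponential gain; the last one provides integrability.\<close>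
    have point: "\<bar>\<bar>y\<bar> - x\<bar> * exp (- ?F y) \<le> e * exp (- ?F y) + ?s * ((x + \<bar>y\<bar>) * exp (B - y\<^sup>2))" for y
    proof (cases "\<bar>\<bar>y\<bar> - x\<bar> < e")
      case True
      then have "\<bar>\<bar>y\<bar> - x\<bar> * exp (- ?F y) \<le> e * exp (- ?F y)"
        by (intro mult_right_mono) auto
      moreover have "0 \<le> ?s * ((x + \<bar>y\<bar>) * exp (B - y\<^sup>2))" using x by simp
      ultimately show ?thesis by linarith
    next
      case False
      have "(N n - 1) * (g x + 2 * \<eta>) \<le> (N n - 1) * f n y"
        using far[OF False] N1 by (intro mult_left_mono) auto
      then have "- ?F y \<le> - ((N n - 1) * (g x + 2 * \<eta>)) + (B - y\<^sup>2)"
        using low[of y] by (simp add: left_diff_distrib)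
      then have "exp (- ?F y) \<le> ?s * exp (B - y\<^sup>2)"
        by (simp flip: exp_add)
      then have "\<bar>\<bar>y\<bar> - x\<bar> * exp (- ?F y) \<le> (x + \<bar>y\<bar>) * (?s * exp (B - y\<^sup>2))"
        using x by (intro mult_mono) auto
      moreover have "0 \<le> e * exp (- ?F y)" using e by simp
      ultimately show ?thesis by (simp add: mult_ac)
    qed
    have "gibbs_abs_mean ?F - x = (\<integral>y. \<bar>y\<bar> * exp (- ?F y) - x * exp (- ?F y) \<partial>lborel) / ?Z"
      using int Zpos by (subst Bochner_Integration.integral_diff) (auto simp: gibbs_abs_mean_def diff_divide_distrib)
    moreover have "\<bar>\<integral>y. \<bar>y\<bar> * exp (- ?F y) - x * exp (- ?F y) \<partial>lborel\<bar> \<le> e * ?Z + ?s * C"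
    proof -
      have "\<bar>\<integral>y. \<bar>y\<bar> * exp (- ?F y) - x * exp (- ?F y) \<partial>lborel\<bar>
          \<le> (\<integral>y. \<bar>\<bar>y\<bar> * exp (- ?F y) - x * exp (- ?F y)\<bar> \<partial>lborel)"
        by (rule integral_abs_bound)
      also have "\<dots> \<le> (\<integral>y. e * exp (- ?F y) + ?s * ((x + \<bar>y\<bar>) * exp (B - y\<^sup>2)) \<partial>lborel)"
      proof (rule integral_mono)
        show "\<bar>\<bar>y\<bar> * exp (- ?F y) - x * exp (- ?F y)\<bar> \<le> e * exp (- ?F y) + ?s * ((x + \<bar>y\<bar>) * exp (B - y\<^sup>2))" for y
          using point[of y] by (simp add: abs_mult flip: left_diff_distrib)
      qed (use int integrable_gaussian_majorant in
          \<open>auto intro!: integrable_abs Bochner_Integration.integrable_diff Bochner_Integration.integrable_add\<close>)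
      also have "\<dots> = e * ?Z + ?s * C"
        unfolding C_def using int integrable_gaussian_majorant
        by (subst Bochner_Integration.integral_add) auto
      finally show ?thesis .
    qed
    ultimately have "\<bar>gibbs_abs_mean ?F - x\<bar> \<le> (e * ?Z + ?s * C) / ?Z"
      using Zpos by (simp add: abs_divide divide_right_mono)
    also have "\<dots> = e + ?s * C / ?Z"
      using Zpos by (simp add: add_divide_distrib)
    also have "?s * C / ?Z \<le> ?s * C / (2 * d * exp (- (N n * (g x + \<eta>))))"
    proof (rule divide_left_mono[OF Z])
      have "0 \<le> C" unfolding C_def using x by (intro integral_nonneg_AE AE_I2) auto
      then show "0 \<le> ?s * C" by simp
      show "0 < ?Z * (2 * d * exp (- (N n * (g x + \<eta>))))" using Zpos d by simp
    qed
    also have "?s * C / (2 * d * exp (- (N n * (g x + \<eta>)))) = C / (2 * d) * (?s / exp (- (N n * (g x + \<eta>))))"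
      by simp
    also have "?s / exp (- (N n * (g x + \<eta>))) = exp (g x + 2 * \<eta>) * exp (- (N n * \<eta>))"
      by (simp add: algebra_simps flip: exp_diff exp_add)
    finally show ?case
      using elim(4) by (simp add: dist_real_def mult_ac)
  qed
qed

section \<open>Gaussian linearisation of the interaction\<close>

lemma finite_configs: "finite (configs n)"
  unfolding configs_def by (intro finite_PiE) auto

lemma configs_nonempty: "configs n \<noteq> {}"
proof -
  have "(\<lambda>j\<in>{1..n}. 0) \<in> configs n"
    by (auto simp: configs_def)
  then show ?thesis by blast
qed

lemma partition_fun_pos: "0 < partition_fun n \<beta> K"
  unfolding partition_fun_def by (intro sum_pos finite_configs configs_nonempty) auto

lemma mean_abs_magnetization_eq_sum:
  "mean_abs_magnetization n \<beta> K =
     (\<Sum>\<omega>\<in>configs n. exp (- \<beta> * hamiltonian n K \<omega>) * \<bar>total_spin n \<omega> / real n\<bar>) / partition_fun n \<beta> K"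
proof -
  have "mean_abs_magnetization n \<beta> K = (\<integral>\<omega>. \<bar>total_spin n \<omega> / real n\<bar> \<partial>point_measure (configs n)
      (\<lambda>\<omega>. exp (- \<beta> * hamiltonian n K \<omega>) / partition_fun n \<beta> K))"
    unfolding mean_abs_magnetization_def blume_capel_def by simp
  also have "\<dots> = (\<Sum>\<omega>\<in>configs n. (exp (- \<beta> * hamiltonian n K \<omega>) / partition_fun n \<beta> K)
      *\<^sub>R \<bar>total_spin n \<omega> / real n\<bar>)"
    using partition_fun_pos[of n \<beta> K] finite_configs
    by (intro lebesgue_integral_point_measure_finite) (auto intro: less_imp_le)
  finally show ?thesis
    by (simp add: sum_divide_distrib mult.commute)
qed

text \<open>
  Once the interaction is replaced by a linear term the spins are independent, and the sum over
  configurations factorises.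
\<close>
lemma sum_configs_exp_linear:
  "(\<Sum>\<omega>\<in>configs n. exp (t * total_spin n \<omega> - \<beta> * (\<Sum>j = 1..n. (\<omega> j)\<^sup>2)))
     = (1 + exp (- \<beta>) * (exp t + exp (- t))) ^ n"
proof -
  have "(\<Sum>\<omega>\<in>configs n. exp (t * total_spin n \<omega> - \<beta> * (\<Sum>j = 1..n. (\<omega> j)\<^sup>2)))
      = (\<Sum>\<omega>\<in>configs n. \<Prod>j\<in>{1..n}. exp (t * \<omega> j - \<beta> * (\<omega> j)\<^sup>2))"
    by (simp add: total_spin_def sum_distrib_left exp_sum flip: sum_subtractf)
  also have "\<dots> = (\<Prod>j\<in>{1..n}. \<Sum>s\<in>{1, 0, -1}. exp (t * s - \<beta> * s\<^sup>2))"
    unfolding configs_def by (rule prod_sum_PiE[symmetric]) auto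
  also have "(\<Sum>s\<in>{1, 0, -1}. exp (t * s - \<beta> * s\<^sup>2)) = 1 + exp (- \<beta>) * (exp t + exp (- t))"
    by (simp add: algebra_simps flip: exp_add)
  finally show ?thesis by simp
qed

text \<open>
  The variance \<open>\<sigma>\<^sup>2 = 1 / (2 n \<beta> K)\<close> is chosen so that the term in \<open>S\<^sup>2\<close> coming from the Gaussian
  cancels the interaction in the Hamiltonian. The remaining exponent is linear in \<open>S\<close>, and its sum over
  configurations is the moment generating function of independent spins at \<open>2 \<beta> K x\<close>.
\<close>
lemma normal_mixture_eq_gibbs:
  assumes n: "0 < n" and \<beta>: "0 < \<beta>" and K: "0 < K"
  defines "\<sigma> \<equiv> 1 / sqrt (2 * real n * \<beta> * K)"
  shows "(\<Sum>\<omega>\<in>configs n. exp (- \<beta> * hamiltonian n K \<omega>) * normal_density (total_spin n \<omega> / real n) \<sigma> x)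
    = (1 + 2 * exp (- \<beta>)) ^ n / sqrt (2 * pi * \<sigma>\<^sup>2) * exp (- (real n * free_energy \<beta> K x))"
proof -
  define a where "a = real n * \<beta> * K"
  have a: "0 < a" using assms by (simp add: a_def)
  have \<sigma>: "2 * \<sigma>\<^sup>2 = 1 / a"
    using assms(1-3) by (simp add: \<sigma>_def a_def power_divide)
  define t where "t = 2 * \<beta> * K * x"
  have "exp (- \<beta> * hamiltonian n K \<omega>) * normal_density (total_spin n \<omega> / real n) \<sigma> x
      = exp (- a * x\<^sup>2) / sqrt (2 * pi * \<sigma>\<^sup>2) * exp (t * total_spin n \<omega> - \<beta> * (\<Sum>j = 1..n. (\<omega> j)\<^sup>2))" for \<omega>
  proof -
    let ?S = "total_spin n \<omega>" and ?Q = "\<Sum>j = 1..n. (\<omega> j)\<^sup>2"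
    have "(x - ?S / real n)\<^sup>2 / (2 * \<sigma>\<^sup>2) = a * (x - ?S / real n)\<^sup>2"
      unfolding \<sigma> by simp
    also have "\<dots> = a * x\<^sup>2 - t * ?S + \<beta> * K / real n * ?S\<^sup>2"
      using n by (simp add: a_def t_def power2_eq_square field_simps)
    finally have sq: "(x - ?S / real n)\<^sup>2 / (2 * \<sigma>\<^sup>2) = a * x\<^sup>2 - t * ?S + \<beta> * K / real n * ?S\<^sup>2" .
    have H: "- \<beta> * hamiltonian n K \<omega> = - \<beta> * ?Q + \<beta> * K / real n * ?S\<^sup>2"
      by (simp add: hamiltonian_def total_spin_def algebra_simps)
    have "- \<beta> * hamiltonian n K \<omega> + - ((x - ?S / real n)\<^sup>2 / (2 * \<sigma>\<^sup>2)) = - a * x\<^sup>2 + (t * ?S - \<beta> * ?Q)"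
      unfolding sq H by simp
    then have "exp (- \<beta> * hamiltonian n K \<omega>) * exp (- ((x - ?S / real n)\<^sup>2 / (2 * \<sigma>\<^sup>2)))
        = exp (- a * x\<^sup>2) * exp (t * ?S - \<beta> * ?Q)"
      by (simp only: flip: exp_add)
    then show ?thesis
      by (simp add: normal_density_def)
  qed
  then have "(\<Sum>\<omega>\<in>configs n. exp (- \<beta> * hamiltonian n K \<omega>) * normal_density (total_spin n \<omega> / real n) \<sigma> x)
      = exp (- a * x\<^sup>2) / sqrt (2 * pi * \<sigma>\<^sup>2) * (1 + exp (- \<beta>) * (exp t + exp (- t))) ^ n"
    by (simp only: sum_configs_exp_linear flip: sum_distrib_left)
  moreover have "(1 + 2 * exp (- \<beta>)) ^ n * exp (- (real n * free_energy \<beta> K x))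
      = exp (- a * x\<^sup>2) * (1 + exp (- \<beta>) * (exp t + exp (- t))) ^ n"
  proof -
    let ?u = "1 + exp (- \<beta>) * (exp t + exp (- t))" and ?v = "1 + 2 * exp (- \<beta>)"
    have u: "0 < ?u" and v: "0 < ?v" by (auto intro!: add_pos_pos mult_pos_pos)
    have "- (real n * free_energy \<beta> K x) = - a * x\<^sup>2 + real n * cumulant_gf \<beta> t"
      by (simp add: free_energy_def a_def t_def algebra_simps)
    moreover have "exp (real n * cumulant_gf \<beta> t) = (?u / ?v) ^ n"
      using u v unfolding cumulant_gf_def by (simp add: exp_of_nat_mult)
    ultimately have "exp (- (real n * free_energy \<beta> K x)) = exp (- a * x\<^sup>2) * (?u / ?v) ^ n"
      by (simp only: exp_add)
    with v show ?thesis by (simp add: power_divide)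
  qed
  ultimately show ?thesis by (simp add: mult_ac)
qed

text \<open>
  By \<open>normal_mixture_eq_gibbs\<close> the density proportional to \<open>exp (- n G)\<close> is the law of \<open>S\<^sub>n / n\<close> plus
  independent Gaussian noise. Smearing changes the mean absolute value by at most the mean absolute
  value of the noise, which is the bound given here.
\<close>
lemma hubbard_stratonovich:
  assumes n: "0 < n" and \<beta>: "0 < \<beta>" and K: "0 < K"
  shows "\<bar>mean_abs_magnetization n \<beta> K - gibbs_abs_mean (\<lambda>x. real n * free_energy \<beta> K x)\<bar>
       \<le> 1 / sqrt (pi * real n * \<beta> * K)"
proof -
  define \<sigma> where "\<sigma> = 1 / sqrt (2 * real n * \<beta> * K)"
  define w where "w \<omega> = exp (- \<beta> * hamiltonian n K \<omega>)" for \<omega>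
  define s where "s \<omega> = total_spin n \<omega> / real n" for \<omega>
  define N where "N \<omega> = normal_density (s \<omega>) \<sigma>" for \<omega>
  define C where "C = (1 + 2 * exp (- \<beta>)) ^ n / sqrt (2 * pi * \<sigma>\<^sup>2)"
  define e where "e = \<sigma> * sqrt (2 / pi)"
  have \<sigma>: "0 < \<sigma>" using assms by (simp add: \<sigma>_def)
  have C: "0 < C" using \<sigma> by (auto simp: C_def intro!: divide_pos_pos zero_less_power add_pos_pos mult_pos_pos)
  have mix: "(\<Sum>\<omega>\<in>configs n. w \<omega> * N \<omega> x) = C * exp (- (real n * free_energy \<beta> K x))" for x
    unfolding w_def N_def s_def C_def \<sigma>_def by (rule normal_mixture_eq_gibbs[OF assms])
  have N0: "integrable lborel (N \<omega>)" "(\<integral>x. N \<omega> x \<partial>lborel) = 1" for \<omega>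
    using \<sigma> by (auto simp: N_def)
  have "has_bochner_integral lborel (\<lambda>x. N \<omega> x * \<bar>x - s \<omega>\<bar>) e" for \<omega>
    using normal_moment_abs_odd[OF \<sigma>, of "s \<omega>" 0] by (simp add: N_def e_def)
  then have N1: "integrable lborel (\<lambda>x. N \<omega> x * \<bar>x - s \<omega>\<bar>)" "(\<integral>x. N \<omega> x * \<bar>x - s \<omega>\<bar> \<partial>lborel) = e" for \<omega>
    by (auto simp: has_bochner_integral_iff)
  have N_nonneg: "0 \<le> N \<omega> x" for \<omega> x
    by (simp add: N_def)
  have [measurable]: "N \<omega> \<in> borel_measurable borel" for \<omega>
    by (simp add: N_def)
  have Nabs: "integrable lborel (\<lambda>x. N \<omega> x * \<bar>x\<bar>)" for \<omega>
  proof (rule Bochner_Integration.integrable_bound)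
    show "integrable lborel (\<lambda>x. N \<omega> x * \<bar>x - s \<omega>\<bar> + N \<omega> x * \<bar>s \<omega>\<bar>)"
      by (intro Bochner_Integration.integrable_add integrable_mult_left N0 N1)
    have "N \<omega> x * \<bar>x\<bar> \<le> N \<omega> x * (\<bar>x - s \<omega>\<bar> + \<bar>s \<omega>\<bar>)" for x
      by (intro mult_left_mono N_nonneg) auto
    then show "AE x in lborel. norm (N \<omega> x * \<bar>x\<bar>) \<le> norm (N \<omega> x * \<bar>x - s \<omega>\<bar> + N \<omega> x * \<bar>s \<omega>\<bar>)"
      using N_nonneg by (auto simp: abs_mult distrib_left)
  qed simp
  have close: "\<bar>(\<integral>x. N \<omega> x * \<bar>x\<bar> \<partial>lborel) - \<bar>s \<omega>\<bar>\<bar> \<le> e" for \<omega>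
  proof -
    have "(\<integral>x. N \<omega> x * \<bar>x\<bar> \<partial>lborel) - \<bar>s \<omega>\<bar> = (\<integral>x. N \<omega> x * \<bar>x\<bar> - N \<omega> x * \<bar>s \<omega>\<bar> \<partial>lborel)"
      using Nabs N0 by (subst Bochner_Integration.integral_diff) auto
    also have "\<bar>\<dots>\<bar> \<le> (\<integral>x. \<bar>N \<omega> x * \<bar>x\<bar> - N \<omega> x * \<bar>s \<omega>\<bar>\<bar> \<partial>lborel)"
      by (rule integral_abs_bound)
    also have "\<dots> \<le> (\<integral>x. N \<omega> x * \<bar>x - s \<omega>\<bar> \<partial>lborel)"
    proof (rule integral_mono)
      show "\<bar>N \<omega> x * \<bar>x\<bar> - N \<omega> x * \<bar>s \<omega>\<bar>\<bar> \<le> N \<omega> x * \<bar>x - s \<omega>\<bar>" for x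
        using mult_left_mono[OF abs_triangle_ineq3[of x "s \<omega>"] N_nonneg[of \<omega> x]] N_nonneg[of \<omega> x]
        by (simp add: abs_mult flip: right_diff_distrib)
    qed (use Nabs N0 N1 in \<open>auto intro!: integrable_abs Bochner_Integration.integrable_diff integrable_mult_left\<close>)
    finally show ?thesis using N1 by simp
  qed
  have Z: "C * (\<integral>x. exp (- (real n * free_energy \<beta> K x)) \<partial>lborel) = partition_fun n \<beta> K"
  proof -
    have "C * (\<integral>x. exp (- (real n * free_energy \<beta> K x)) \<partial>lborel)
        = (\<integral>x. (\<Sum>\<omega>\<in>configs n. w \<omega> * N \<omega> x) \<partial>lborel)"
      unfolding mix by simp
    also have "\<dots> = (\<Sum>\<omega>\<in>configs n. w \<omega>)"
      using N0 by (subst Bochner_Integration.integral_sum) auto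
    finally show ?thesis by (simp add: partition_fun_def w_def)
  qed
  have A: "C * (\<integral>x. \<bar>x\<bar> * exp (- (real n * free_energy \<beta> K x)) \<partial>lborel)
      = (\<Sum>\<omega>\<in>configs n. w \<omega> * (\<integral>x. N \<omega> x * \<bar>x\<bar> \<partial>lborel))"
  proof -
    have "C * (\<integral>x. \<bar>x\<bar> * exp (- (real n * free_energy \<beta> K x)) \<partial>lborel)
        = (\<integral>x. (\<Sum>\<omega>\<in>configs n. w \<omega> * N \<omega> x) * \<bar>x\<bar> \<partial>lborel)"
      unfolding mix by (simp add: mult_ac)
    also have "\<dots> = (\<integral>x. (\<Sum>\<omega>\<in>configs n. w \<omega> * (N \<omega> x * \<bar>x\<bar>)) \<partial>lborel)"
      by (simp add: sum_distrib_right mult.assoc)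
    also have "\<dots> = (\<Sum>\<omega>\<in>configs n. w \<omega> * (\<integral>x. N \<omega> x * \<bar>x\<bar> \<partial>lborel))"
      using Nabs by (subst Bochner_Integration.integral_sum) auto
    finally show ?thesis .
  qed
  let ?Z = "partition_fun n \<beta> K"
  have Zpos: "0 < ?Z" by (rule partition_fun_pos)
  have "gibbs_abs_mean (\<lambda>x. real n * free_energy \<beta> K x)
      = (C * (\<integral>x. \<bar>x\<bar> * exp (- (real n * free_energy \<beta> K x)) \<partial>lborel))
        / (C * (\<integral>x. exp (- (real n * free_energy \<beta> K x)) \<partial>lborel))"
    using C by (simp add: gibbs_abs_mean_def)
  then have gibbs: "gibbs_abs_mean (\<lambda>x. real n * free_energy \<beta> K x)
      = (\<Sum>\<omega>\<in>configs n. w \<omega> * (\<integral>x. N \<omega> x * \<bar>x\<bar> \<partial>lborel)) / ?Z"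
    unfolding A Z .
  have "mean_abs_magnetization n \<beta> K - gibbs_abs_mean (\<lambda>x. real n * free_energy \<beta> K x)
      = (\<Sum>\<omega>\<in>configs n. w \<omega> * (\<bar>s \<omega>\<bar> - (\<integral>x. N \<omega> x * \<bar>x\<bar> \<partial>lborel))) / ?Z"
    unfolding gibbs mean_abs_magnetization_eq_sum
    by (simp add: w_def s_def right_diff_distrib sum_subtractf diff_divide_distrib)
  also have "\<bar>\<dots>\<bar> \<le> (\<Sum>\<omega>\<in>configs n. w \<omega> * e) / ?Z"
  proof -
    have "\<bar>\<Sum>\<omega>\<in>configs n. w \<omega> * (\<bar>s \<omega>\<bar> - (\<integral>x. N \<omega> x * \<bar>x\<bar> \<partial>lborel))\<bar> \<le> (\<Sum>\<omega>\<in>configs n. w \<omega> * e)"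
    proof (rule order_trans[OF sum_abs sum_mono])
      fix \<omega>
      show "\<bar>w \<omega> * (\<bar>s \<omega>\<bar> - (\<integral>x. N \<omega> x * \<bar>x\<bar> \<partial>lborel))\<bar> \<le> w \<omega> * e"
        using close[of \<omega>] by (simp add: abs_mult abs_minus_commute w_def)
    qed
    with Zpos show ?thesis by (simp add: abs_divide divide_right_mono)
  qed
  also have "(\<Sum>\<omega>\<in>configs n. w \<omega> * e) / ?Z = e"
    using Zpos by (simp add: partition_fun_def w_def flip: sum_distrib_right)
  also have "e = 1 / sqrt (pi * real n * \<beta> * K)"
    using assms by (simp add: e_def \<sigma>_def real_sqrt_mult real_sqrt_divide)
  finally show ?thesis .
qed

section \<open>Mean magnetization on the critical scale\<close>

context critical_scaling begin

lemma gibbs_limit: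
  "(\<lambda>n. gibbs_abs_mean (f n)) \<longlonglongrightarrow> gibbs_abs_mean landau" "0 < gibbs_abs_mean landau"
proof -
  obtain B where B: "\<forall>\<^sub>F n in sequentially. \<forall>y. y\<^sup>2 - B \<le> f n y"
    using f_lower_bound by blast
  have "continuous_on UNIV landau"
    unfolding landau_def[abs_def] by (intro continuous_intros)
  from gibbs_abs_mean_tendsto[OF continuous_on_scaled_energy this f_limit B]
  show "(\<lambda>n. gibbs_abs_mean (f n)) \<longlonglongrightarrow> gibbs_abs_mean landau" "0 < gibbs_abs_mean landau" .
qed

text \<open>
  The case of a large factor \<open>N\<close>: the quadratic coefficient has to be negative, since only then do
  the wells lie at a nonzero distance from the origin.
\<close>
lemma gibbs_laplace_limit:
  assumes "L < 0" "filterlim N at_top sequentially"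
  shows "(\<lambda>n. gibbs_abs_mean (\<lambda>y. N n * f n y)) \<longlonglongrightarrow> positive_min_point landau"
proof -
  obtain B where B: "\<forall>\<^sub>F n in sequentially. \<forall>y. y\<^sup>2 - B \<le> f n y"
    using f_lower_bound by blast
  have "\<forall>\<^sub>F n in sequentially. quasiconvex_halfline (f n)"
    using eventually_admissible by eventually_elim (simp add: scaled_energy_quasiconvex)
  moreover have "isCont landau (positive_min_point landau)"
    unfolding landau_def[abs_def] by (intro continuous_intros)
  ultimately show ?thesis
    using double_well_unique_min[OF assms(1) c4_pos landau_def] assms(2)
    by (intro gibbs_abs_mean_laplace[OF _ scaled_energy_abs continuous_on_scaled_energy _ f_limit B])
qed

text \<open>
  The Hubbard--Stratonovich error, divided by the length scale \<open>\<epsilon>s n\<close>, is of order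
  \<open>1 / (sqrt n \<epsilon>s n)\<close>.
\<close>
lemma mean_abs_magnetization_limit:
  assumes large: "filterlim (\<lambda>n. sqrt (real n) * \<epsilon>s n) at_top sequentially"
    and gibbs: "(\<lambda>n. gibbs_abs_mean (\<lambda>y. (real n * \<epsilon>s n ^ 4) * f n y)) \<longlonglongrightarrow> l"
  shows "(\<lambda>n. mean_abs_magnetization n (\<beta>s n) (Ks n) / \<epsilon>s n) \<longlonglongrightarrow> l"
proof -
  define err where "err n = 1 / (sqrt (pi * \<beta>s n * Ks n) * (sqrt (real n) * \<epsilon>s n))" for n
  have lim: "(\<lambda>n. sqrt (pi * \<beta>s n * Ks n)) \<longlonglongrightarrow> sqrt (pi * \<beta> * K_curve \<beta>)"
    by (intro tendsto_intros \<beta>s Ks)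
  have pos: "0 < sqrt (pi * \<beta> * K_curve \<beta>)"
    using \<beta> K_curve_pos by simp
  have err: "err \<longlonglongrightarrow> 0"
    unfolding err_def
    by (rule tendsto_divide_0[OF tendsto_const])
       (rule filterlim_at_top_imp_at_infinity, rule filterlim_tendsto_pos_mult_at_top[OF lim pos large])
  have "(\<lambda>n. mean_abs_magnetization n (\<beta>s n) (Ks n) / \<epsilon>s n
      - gibbs_abs_mean (\<lambda>y. (real n * \<epsilon>s n ^ 4) * f n y)) \<longlonglongrightarrow> 0"
  proof (rule tendsto_0_le[OF err, where K = 1])
    show "\<forall>\<^sub>F n in sequentially. norm (mean_abs_magnetization n (\<beta>s n) (Ks n) / \<epsilon>s n
      - gibbs_abs_mean (\<lambda>y. (real n * \<epsilon>s n ^ 4) * f n y)) \<le> norm (err n) * 1"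
      using eventually_admissible eventually_gt_at_top[of 0]
    proof eventually_elim
      case (elim n)
      let ?h = "\<lambda>x. real n * free_energy (\<beta>s n) (Ks n) x"
      have "(\<lambda>y. (real n * \<epsilon>s n ^ 4) * f n y) = (\<lambda>y. ?h (\<epsilon>s n * y))"
        using elim by (simp add: scaled_energy_def fun_eq_iff)
      then have scale: "gibbs_abs_mean (\<lambda>y. (real n * \<epsilon>s n ^ 4) * f n y) = gibbs_abs_mean ?h / \<epsilon>s n"
        using gibbs_abs_mean_scale[of "\<epsilon>s n" ?h] elim by simp
      have "\<bar>mean_abs_magnetization n (\<beta>s n) (Ks n) - gibbs_abs_mean ?h\<bar> / \<epsilon>s n
          \<le> 1 / sqrt (pi * real n * \<beta>s n * Ks n) / \<epsilon>s n"
        using elim by (intro divide_right_mono hubbard_stratonovich) auto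
      also have "\<dots> = err n"
        by (simp add: err_def real_sqrt_mult mult_ac)
      finally show ?case
        using elim by (simp add: scale abs_divide flip: diff_divide_distrib)
    qed
  qed
  from tendsto_add[OF this gibbs] show ?thesis by simp
qed

end

section \<open>Sequences approaching the second-order curve\<close>

lemma K_curve_has_deriv:
  assumes "0 < \<beta>"
  shows "(K_curve has_real_derivative deriv K_curve \<beta>) (at \<beta>)"
proof -
  have "(K_curve has_real_derivative (exp \<beta> * (4 * \<beta>) - (exp \<beta> + 2) * 4) / (4 * \<beta> * (4 * \<beta>))) (at \<beta>)"
    unfolding K_curve_def[abs_def] using assms by (auto intro!: derivative_eq_intros)
  then show ?thesis by (metis DERIV_imp_deriv)
qed

lemma spin_second_moment_K_curve:
  assumes "0 < \<beta>"
  shows "2 * spin_second_moment \<beta> * \<beta> * K_curve \<beta> = 1"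
proof -
  have "2 * (2 / E) * \<beta> * (E / (4 * \<beta>)) = 1" if "0 < E" for E :: real
    using that assms by (simp add: field_simps)
  from this[of "exp \<beta> + 2"] show ?thesis
    unfolding spin_second_moment_def K_curve_def by (simp add: add_pos_pos)
qed

lemma quadratic_coeff_eq:
  assumes "0 < \<beta>"
  shows "quadratic_coeff \<beta> K = 2 * spin_second_moment \<beta> * \<beta>\<^sup>2 * K * (K_curve \<beta> - K)"
proof -
  have "quadratic_coeff \<beta> K = \<beta> * K * (2 * spin_second_moment \<beta> * \<beta> * K_curve \<beta> - 2 * spin_second_moment \<beta> * \<beta> * K)"
    by (simp add: quadratic_coeff_def spin_second_moment_K_curve[OF assms])
  then show ?thesis
    by (simp add: power2_eq_square algebra_simps)
qed

text \<open>
  The quadratic coefficient is a nonvanishing factor times the signed distance \<open>K_curve \<beta> - K\<close> below the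
  curve, so its rate of change along the line in direction \<open>(b, k)\<close> comes from the slope of the curve.
\<close>
lemma quadratic_coeff_line_limit:
  assumes \<beta>: "0 < \<beta>" and h: "filterlim h (at 0) sequentially"
  shows "(\<lambda>n. quadratic_coeff (\<beta> + b * h n) (K_curve \<beta> + k * h n) / h n)
     \<longlonglongrightarrow> \<beta> * (deriv K_curve \<beta> * b - k)"
proof -
  have h0: "h \<longlonglongrightarrow> 0" and hne: "\<forall>\<^sub>F n in sequentially. h n \<noteq> 0"
    using h by (auto simp: filterlim_at)
  have \<beta>s: "(\<lambda>n. \<beta> + b * h n) \<longlonglongrightarrow> \<beta> + b * 0" and Ks: "(\<lambda>n. K_curve \<beta> + k * h n) \<longlonglongrightarrow> K_curve \<beta> + k * 0"
    by (intro tendsto_intros h0)+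
  have "((\<lambda>t. K_curve (\<beta> + b * t)) has_real_derivative deriv K_curve \<beta> * b) (at 0)"
    by (rule DERIV_chain2[where f = K_curve]) (use K_curve_has_deriv[OF \<beta>] in \<open>auto intro!: derivative_eq_intros\<close>)
  then have "((\<lambda>t. (K_curve (\<beta> + b * t) - K_curve \<beta>) / t) \<longlongrightarrow> deriv K_curve \<beta> * b) (at 0)"
    by (simp add: DERIV_def)
  from filterlim_compose[OF this h]
  have slope: "(\<lambda>n. (K_curve (\<beta> + b * h n) - K_curve \<beta>) / h n) \<longlonglongrightarrow> deriv K_curve \<beta> * b" .
  have "(\<lambda>n. 2 * spin_second_moment (\<beta> + b * h n) * (\<beta> + b * h n)\<^sup>2 * (K_curve \<beta> + k * h n)
        * ((K_curve (\<beta> + b * h n) - K_curve \<beta>) / h n - k))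
      \<longlonglongrightarrow> 2 * spin_second_moment (\<beta> + b * 0) * (\<beta> + b * 0)\<^sup>2 * (K_curve \<beta> + k * 0) * (deriv K_curve \<beta> * b - k)"
    unfolding spin_second_moment_def
    by (intro tendsto_intros \<beta>s Ks slope) (simp add: add_pos_pos less_imp_neq[symmetric])
  also have "2 * spin_second_moment (\<beta> + b * 0) * (\<beta> + b * 0)\<^sup>2 * (K_curve \<beta> + k * 0) = \<beta>"
    using spin_second_moment_K_curve[OF \<beta>] by (simp add: power2_eq_square mult_ac)
  finally show ?thesis
  proof (rule Lim_transform_eventually)
    have "\<forall>\<^sub>F n in sequentially. 0 < \<beta> + b * h n"
      using order_tendstoD(1)[OF \<beta>s, of 0] \<beta> by simp
    with hne show "\<forall>\<^sub>F n in sequentially. 2 * spin_second_moment (\<beta> + b * h n) * (\<beta> + b * h n)\<^sup>2 * (K_curve \<beta> + k * h n)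
        * ((K_curve (\<beta> + b * h n) - K_curve \<beta>) / h n - k)
        = quadratic_coeff (\<beta> + b * h n) (K_curve \<beta> + k * h n) / h n"
    proof eventually_elim
      case (elim n)
      have "(K_curve (\<beta> + b * h n) - K_curve \<beta>) / h n - k = (K_curve (\<beta> + b * h n) - (K_curve \<beta> + k * h n)) / h n"
        using elim by (simp add: field_simps)
      then show ?case
        by (simp add: quadratic_coeff_eq[OF elim(2)])
    qed
  qed
qed

lemma powr_neg_filterlim_at_0:
  assumes "0 < a"
  shows "filterlim (\<lambda>n. real n powr - a) (at 0) sequentially"
  unfolding filterlim_at using assms
  by (auto intro!: eventually_mono[OF eventually_gt_at_top[of 0]] tendsto_neg_powr filterlim_real_sequentially)

lemma powr_pos_filterlim_at_top:
  assumes "0 < a"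
  shows "filterlim (\<lambda>n. real n powr a) at_top sequentially"
  using assms by real_asymp

text \<open>
  The quadratic coefficient is of order \<open>n powr (- \<alpha>)\<close>, so on the length scale \<open>n powr (- \<gamma>)\<close> it survives
  in the limit exactly when \<open>2 \<gamma> = \<alpha>\<close>.
\<close>
lemma critical_scaling_power_law:
  assumes \<beta>: "0 < \<beta>" "\<beta> < beta_crit" and \<gamma>: "0 < \<gamma>" "2 * \<gamma> \<le> \<alpha>"
  shows "critical_scaling \<beta> (if 2 * \<gamma> = \<alpha> then \<beta> * (deriv K_curve \<beta> * b - k) else 0)
     (beta_seq \<beta> b \<alpha>) (K_seq \<beta> k \<alpha>) (\<lambda>n. real n powr - \<gamma>)"
proof
  let ?h = "\<lambda>n. real n powr - \<alpha>"
  have \<alpha>: "0 < \<alpha>" using \<gamma> by simp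
  note h = powr_neg_filterlim_at_0[OF \<alpha>]
  then have h0: "?h \<longlonglongrightarrow> 0" by (simp add: filterlim_at)
  have \<beta>s: "beta_seq \<beta> b \<alpha> n = \<beta> + b * ?h n" and Ks: "K_seq \<beta> k \<alpha> n = K_curve \<beta> + k * ?h n" for n
    by (simp_all add: beta_seq_def K_seq_def powr_minus divide_inverse)
  show "beta_seq \<beta> b \<alpha> \<longlonglongrightarrow> \<beta>"
    unfolding \<beta>s[abs_def] using tendsto_add[OF tendsto_const tendsto_mult[OF tendsto_const h0], of \<beta> b] by simp
  show "K_seq \<beta> k \<alpha> \<longlonglongrightarrow> K_curve \<beta>"
    unfolding Ks[abs_def] using tendsto_add[OF tendsto_const tendsto_mult[OF tendsto_const h0], of "K_curve \<beta>" k] by simp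
  show "(\<lambda>n. real n powr - \<gamma>) \<longlonglongrightarrow> 0"
    using powr_neg_filterlim_at_0[OF \<gamma>(1)] by (simp add: filterlim_at)
  show "\<forall>\<^sub>F n in sequentially. 0 < real n powr - \<gamma>"
    using eventually_gt_at_top[of 0] by eventually_elim simp
  have ratio: "(\<lambda>n. real n powr (2 * \<gamma> - \<alpha>)) \<longlonglongrightarrow> (if 2 * \<gamma> = \<alpha> then 1 else 0)"
  proof (cases "2 * \<gamma> = \<alpha>")
    case True
    have "\<forall>\<^sub>F n in sequentially. 1 = real n powr (2 * \<gamma> - \<alpha>)"
      using eventually_gt_at_top[of 0] by eventually_elim (simp add: True)
    then show ?thesis
      unfolding True by (auto intro: Lim_transform_eventually[OF tendsto_const])
  next
    case False
    then show ?thesis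
      using \<gamma> by (auto intro!: tendsto_neg_powr filterlim_real_sequentially)
  qed
  have "(\<lambda>n. quadratic_coeff (beta_seq \<beta> b \<alpha> n) (K_seq \<beta> k \<alpha> n) / ?h n * real n powr (2 * \<gamma> - \<alpha>))
      \<longlonglongrightarrow> \<beta> * (deriv K_curve \<beta> * b - k) * (if 2 * \<gamma> = \<alpha> then 1 else 0)"
    unfolding \<beta>s Ks by (intro tendsto_mult ratio quadratic_coeff_line_limit \<beta> h)
  then have "(\<lambda>n. quadratic_coeff (beta_seq \<beta> b \<alpha> n) (K_seq \<beta> k \<alpha> n) / ?h n * real n powr (2 * \<gamma> - \<alpha>))
      \<longlonglongrightarrow> (if 2 * \<gamma> = \<alpha> then \<beta> * (deriv K_curve \<beta> * b - k) else 0)"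
    by (simp split: if_splits)
  then show "(\<lambda>n. quadratic_coeff (beta_seq \<beta> b \<alpha> n) (K_seq \<beta> k \<alpha> n) / (real n powr - \<gamma>)\<^sup>2)
      \<longlonglongrightarrow> (if 2 * \<gamma> = \<alpha> then \<beta> * (deriv K_curve \<beta> * b - k) else 0)"
  proof (rule Lim_transform_eventually)
    show "\<forall>\<^sub>F n in sequentially. quadratic_coeff (beta_seq \<beta> b \<alpha> n) (K_seq \<beta> k \<alpha> n) / ?h n * real n powr (2 * \<gamma> - \<alpha>)
      = quadratic_coeff (beta_seq \<beta> b \<alpha> n) (K_seq \<beta> k \<alpha> n) / (real n powr - \<gamma>)\<^sup>2"
      using eventually_gt_at_top[of 0]
    proof eventually_elim
      case (elim n)
      have "real n powr (2 * \<gamma> - \<alpha>) = ?h n / (real n powr - \<gamma>)\<^sup>2"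
        using elim by (simp add: power2_eq_square flip: powr_add powr_diff)
      then show ?case using elim by simp
    qed
  qed
qed (use \<beta> in auto)

lemma asymp_equiv_power_law:
  assumes "(\<lambda>n. a n / real n powr - \<gamma>) \<longlonglongrightarrow> l" "l \<noteq> 0"
  shows "a \<sim>[sequentially] (\<lambda>n. l / real n powr \<gamma>)"
proof -
  have "a \<sim>[sequentially] (\<lambda>n. l * real n powr - \<gamma>)"
    by (rule asymp_equivI'_const[OF assms])
  then show ?thesis
    by (simp add: powr_minus divide_inverse)
qed

theorem theorem5p1:
  fixes \<beta> b k :: real
  assumes "0 < \<beta>" and "\<beta> < beta_crit"
    and "b \<in> {1, 0, -1}"
    and "k \<noteq> 0"
    and "deriv K_curve \<beta> * b - k < 0"
  shows
    "(\<forall>\<alpha>>0.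
        m_seq \<beta> b k \<alpha> \<sim>[sequentially] (\<lambda>n. x_bar \<beta> b k / real n powr (\<alpha> / 2)) \<and>
        (b \<noteq> 0 \<longrightarrow>
          m_seq \<beta> b k \<alpha> \<sim>[sequentially]
            (\<lambda>n. x_bar \<beta> b k * \<bar>\<beta> - beta_seq \<beta> b \<alpha> n\<bar> powr (1 / 2))))
     \<and>
     (\<forall>\<alpha>. 0 < \<alpha> \<and> \<alpha> < 1 / 2 \<longrightarrow>
        E_seq \<beta> b k \<alpha> \<sim>[sequentially] (\<lambda>n. x_bar \<beta> b k / real n powr (\<alpha> / 2)) \<and>
        (\<lambda>n. x_bar \<beta> b k / real n powr (\<alpha> / 2)) \<sim>[sequentially] m_seq \<beta> b k \<alpha>)
     \<and>
     (\<forall>\<alpha>>1 / 2.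
        E_seq \<beta> b k \<alpha> \<sim>[sequentially] (\<lambda>n. y_bar \<beta> / real n powr (1 / 4)) \<and>
        filterlim (\<lambda>n. (y_bar \<beta> / real n powr (1 / 4)) / m_seq \<beta> b k \<alpha> n) at_top sequentially)
     \<and>
     (E_seq \<beta> b k (1 / 2) \<sim>[sequentially] (\<lambda>n. z_bar \<beta> b k / real n powr (1 / 4)) \<and>
      (\<lambda>n. z_bar \<beta> b k / real n powr (1 / 4)) \<sim>[sequentially]
        (\<lambda>n. z_bar \<beta> b k * m_seq \<beta> b k (1 / 2) n / x_bar \<beta> b k))"
proof -
  define g2 where "g2 = \<beta> * (deriv K_curve \<beta> * b - k)"
  have g2: "g2 < 0" unfolding g2_def using assms by (intro mult_pos_neg)
  have scaling: "critical_scaling \<beta> (if 2 * \<gamma> = \<alpha> then g2 else 0) (beta_seq \<beta> b \<alpha>) (K_seq \<beta> k \<alpha>) (\<lambda>n. real n powr - \<gamma>)"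
    if "0 < \<gamma>" "2 * \<gamma> \<le> \<alpha>" for \<gamma> \<alpha>
    unfolding g2_def using assms that by (intro critical_scaling_power_law)
  have well: "critical_scaling \<beta> g2 (beta_seq \<beta> b \<alpha>) (K_seq \<beta> k \<alpha>) (\<lambda>n. real n powr - (\<alpha> / 2))" if "0 < \<alpha>" for \<alpha>
    using scaling[of "\<alpha> / 2" \<alpha>] that by simp
  have landau: "critical_scaling.landau \<beta> g2 = gl_poly \<beta> b k"
    using critical_scaling.landau_def[OF well[of 1]] by (simp add: fun_eq_iff gl_poly_def g2_def)
  have x_bar: "positive_min_point (critical_scaling.landau \<beta> g2) = x_bar \<beta> b k"
    unfolding landau x_bar_def ..
  have x_pos: "0 < x_bar \<beta> b k"
    using double_well_unique_min(1)[OF g2 critical_scaling.c4_pos[OF well[of 1]] critical_scaling.landau_def[OF well[of 1]]]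
    unfolding x_bar by simp

  have m_lim: "(\<lambda>n. m_seq \<beta> b k \<alpha> n / real n powr - (\<alpha> / 2)) \<longlonglongrightarrow> x_bar \<beta> b k" if "0 < \<alpha>" for \<alpha>
    using critical_scaling.magnetization_limit[OF well[OF that] g2] unfolding x_bar m_seq_def .
  have m: "m_seq \<beta> b k \<alpha> \<sim>[sequentially] (\<lambda>n. x_bar \<beta> b k / real n powr (\<alpha> / 2))" if "0 < \<alpha>" for \<alpha>
    using x_pos by (intro asymp_equiv_power_law m_lim that) auto
  have part_a: "m_seq \<beta> b k \<alpha> \<sim>[sequentially] (\<lambda>n. x_bar \<beta> b k * \<bar>\<beta> - beta_seq \<beta> b \<alpha> n\<bar> powr (1 / 2))"
    if "0 < \<alpha>" "b \<noteq> 0" for \<alpha>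
  proof -
    have "\<bar>b\<bar> = 1" using assms(3) that(2) by auto
    then have "\<bar>\<beta> - beta_seq \<beta> b \<alpha> n\<bar> = real n powr - \<alpha>" for n
      by (simp add: beta_seq_def abs_divide powr_minus_divide)
    then have "x_bar \<beta> b k * \<bar>\<beta> - beta_seq \<beta> b \<alpha> n\<bar> powr (1 / 2) = x_bar \<beta> b k * real n powr - (\<alpha> / 2)" for n
      by (simp only: powr_powr) simp
    then have "x_bar \<beta> b k * \<bar>\<beta> - beta_seq \<beta> b \<alpha> n\<bar> powr (1 / 2) = x_bar \<beta> b k / real n powr (\<alpha> / 2)" for n
      by (simp add: powr_minus_divide)
    with m[OF that(1)] show ?thesis by simp
  qed

  have part_b: "E_seq \<beta> b k \<alpha> \<sim>[sequentially] (\<lambda>n. x_bar \<beta> b k / real n powr (\<alpha> / 2))"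
    if \<alpha>: "0 < \<alpha>" "\<alpha> < 1 / 2" for \<alpha>
  proof (rule asymp_equiv_power_law)
    interpret critical_scaling \<beta> g2 "beta_seq \<beta> b \<alpha>" "K_seq \<beta> k \<alpha>" "\<lambda>n. real n powr - (\<alpha> / 2)"
      by (rule well[OF \<alpha>(1)])
    have "filterlim (\<lambda>n. sqrt (real n) * real n powr - (\<alpha> / 2)) at_top sequentially"
      using \<alpha> by real_asymp
    moreover have "filterlim (\<lambda>n. real n * (real n powr - (\<alpha> / 2)) ^ 4) at_top sequentially"
      using \<alpha> by real_asymp
    ultimately show "(\<lambda>n. E_seq \<beta> b k \<alpha> n / real n powr - (\<alpha> / 2)) \<longlonglongrightarrow> x_bar \<beta> b k"
      unfolding E_seq_def x_bar[symmetric]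
      by (intro mean_abs_magnetization_limit gibbs_laplace_limit g2)
  qed (use x_pos in simp)

  \<comment> \<open>The scale \<open>n powr (- 1 / 4)\<close> is the one for which \<open>n \<epsilon> ^ 4 = 1\<close>.\<close>
  have quartic_scale: "(\<lambda>n. E_seq \<beta> b k \<alpha> n / real n powr - (1 / 4)) \<longlonglongrightarrow> gibbs_abs_mean (critical_scaling.landau \<beta> L)
      \<and> 0 < gibbs_abs_mean (critical_scaling.landau \<beta> L)"
    if "1 / 2 \<le> \<alpha>" "L = (if 1 / 2 = \<alpha> then g2 else 0)" for \<alpha> L
  proof -
    interpret critical_scaling \<beta> L "beta_seq \<beta> b \<alpha>" "K_seq \<beta> k \<alpha>" "\<lambda>n. real n powr - (1 / 4)"
      using scaling[of "1 / 4" \<alpha>] that by simp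
    have large: "filterlim (\<lambda>n. sqrt (real n) * real n powr - (1 / 4)) at_top sequentially"
      by real_asymp
    have "(\<lambda>n. gibbs_abs_mean (\<lambda>y. (real n * (real n powr - (1 / 4)) ^ 4) * f n y)) \<longlonglongrightarrow> gibbs_abs_mean landau"
    proof (rule Lim_transform_eventually[OF gibbs_limit(1)])
      show "\<forall>\<^sub>F n in sequentially. gibbs_abs_mean (f n)
          = gibbs_abs_mean (\<lambda>y. (real n * (real n powr - (1 / 4)) ^ 4) * f n y)"
        using eventually_gt_at_top[of 0]
      proof eventually_elim
        case (elim n)
        then have "(real n powr - (1 / 4)) ^ 4 = real n powr - 1"
          by (simp add: powr_power)
        with elim show ?case by (simp add: powr_minus)
      qed
    qed
    from mean_abs_magnetization_limit[OF large this] gibbs_limit(2) show ?thesis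
      unfolding E_seq_def by simp
  qed

  have y_bar: "gibbs_abs_mean (critical_scaling.landau \<beta> 0) = y_bar \<beta>"
  proof -
    have "critical_scaling \<beta> 0 (beta_seq \<beta> b 1) (K_seq \<beta> k 1) (\<lambda>n. real n powr - (1 / 4))"
      using scaling[of "1 / 4" 1] by simp
    then have "critical_scaling.landau \<beta> 0 = gl_poly_tilde \<beta>"
      using critical_scaling.landau_def by (simp add: fun_eq_iff gl_poly_tilde_def)
    then show ?thesis by (simp add: y_bar_def)
  qed
  have c_lim: "(\<lambda>n. E_seq \<beta> b k \<alpha> n / real n powr - (1 / 4)) \<longlonglongrightarrow> y_bar \<beta>" and y_pos: "0 < y_bar \<beta>"
    if "1 / 2 < \<alpha>" for \<alpha>
    using quartic_scale[of \<alpha> 0] that by (auto simp: y_bar)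
  have part_c: "filterlim (\<lambda>n. (y_bar \<beta> / real n powr (1 / 4)) / m_seq \<beta> b k \<alpha> n) at_top sequentially"
    if \<alpha>: "1 / 2 < \<alpha>" for \<alpha>
  proof -
    have "(\<lambda>n. y_bar \<beta> / (m_seq \<beta> b k \<alpha> n / real n powr - (\<alpha> / 2))) \<longlonglongrightarrow> y_bar \<beta> / x_bar \<beta> b k"
      using \<alpha> x_pos by (intro tendsto_divide tendsto_const m_lim) auto
    moreover have "0 < y_bar \<beta> / x_bar \<beta> b k"
      using x_pos y_pos[OF \<alpha>] by simp
    moreover have "filterlim (\<lambda>n. real n powr (\<alpha> / 2 - 1 / 4)) at_top sequentially"
      using \<alpha> by (intro powr_pos_filterlim_at_top) simp
    ultimately have "filterlim (\<lambda>n. y_bar \<beta> / (m_seq \<beta> b k \<alpha> n / real n powr - (\<alpha> / 2)) * real n powr (\<alpha> / 2 - 1 / 4))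
        at_top sequentially"
      by (rule filterlim_tendsto_pos_mult_at_top)
    then show ?thesis
    proof (rule filterlim_mono_eventually[OF _ order_refl order_refl])
      show "\<forall>\<^sub>F n in sequentially. y_bar \<beta> / (m_seq \<beta> b k \<alpha> n / real n powr - (\<alpha> / 2)) * real n powr (\<alpha> / 2 - 1 / 4)
          = (y_bar \<beta> / real n powr (1 / 4)) / m_seq \<beta> b k \<alpha> n"
        using eventually_gt_at_top[of 0]
        by eventually_elim (simp only: powr_diff powr_minus, simp add: field_simps)
    qed
  qed

  have z_bar: "gibbs_abs_mean (critical_scaling.landau \<beta> g2) = z_bar \<beta> b k"
    unfolding landau z_bar_def ..
  have d_lim: "(\<lambda>n. E_seq \<beta> b k (1 / 2) n / real n powr - (1 / 4)) \<longlonglongrightarrow> z_bar \<beta> b k" and z_pos: "0 < z_bar \<beta> b k"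
    using quartic_scale[of "1 / 2" g2] by (auto simp: z_bar)
  have part_d: "(\<lambda>n. z_bar \<beta> b k / real n powr (1 / 4)) \<sim>[sequentially]
        (\<lambda>n. z_bar \<beta> b k * m_seq \<beta> b k (1 / 2) n / x_bar \<beta> b k)"
  proof -
    have "(\<lambda>n. z_bar \<beta> b k / x_bar \<beta> b k * (x_bar \<beta> b k / real n powr (1 / 4))) \<sim>[sequentially]
        (\<lambda>n. z_bar \<beta> b k / x_bar \<beta> b k * m_seq \<beta> b k (1 / 2) n)"
      using m[of "1 / 2"] by (intro asymp_equiv_mult asymp_equiv_refl) (simp add: asymp_equiv_sym)
    with x_pos show ?thesis by simp
  qed

  have E_c: "E_seq \<beta> b k \<alpha> \<sim>[sequentially] (\<lambda>n. y_bar \<beta> / real n powr (1 / 4))" if "1 / 2 < \<alpha>" for \<alpha>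
    using asymp_equiv_power_law[OF c_lim[OF that]] y_pos[OF that] by simp
  have E_d: "E_seq \<beta> b k (1 / 2) \<sim>[sequentially] (\<lambda>n. z_bar \<beta> b k / real n powr (1 / 4))"
    using asymp_equiv_power_law[OF d_lim] z_pos by simp
  show ?thesis
    by (intro conjI allI impI m part_a part_b part_c part_d E_c E_d asymp_equiv_symI[OF m]) auto
qed

end
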